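(* Let $q$ be a prime number, let $\mathscr{C}=\mathrm{Top}_{mtr}$ be the category of metrizable topological spaces and continuous maps, $A=\mathbb{Z}_q$ the $q$-adic integers, $F=\mathbb{Z}_q\times\mathbb{Z}_q$, $p:F\to A$ the second projection, and $1_F=(1,1)$. For continuous $x:U\to\mathbb{Z}_q$ identify $\llbracket x\rrbracket$ with $U\times\mathbb{Z}_q$ and, for continuous $f:U\times\mathbb{Z}_q\to\mathbb{Z}_q$, define $$\Big(\sum^{x}f\Big)(u)=\sum_{i=1}^{x(u)}f(u,i),\qquad f^\flat:U\times\mathbb{Z}_q\times\mathbb{Z}_q\to U\times\mathbb{Z}_q,\quad f^\flat(u,i,j)=\Big(u,\ j+\sum_{k=1}^{i-1}f(u,k)\Big).$$ Then these data make $\mathbb{Z}_q$ into a commutative dependent adder in $\mathrm{Top}_{mtr}$.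
   Context: For a continuous function $f:\mathbb{Z}_q\to\mathbb{Z}_q$ and $x\in\mathbb{Z}_q$, $\sum_{i=1}^{x}f(i):=\lim_{n\to\infty}\sum_{i=1}^{x_n}f(i)$ where $(x_n)$ is any sequence of natural numbers converging $q$-adically to $x$ (the limit exists and is independent of the sequence). The identification $U\times\mathbb{Z}_q\cong\llbracket x\rrbracket$ sends $(u,t)$ to $(u,(t,x(u)))$. Let $\mathscr{C}$ be a category with finite limits and terminal object $*$. A dependent adder in $\mathscr{C}$ consists of: (1) an object $A$; (2) a morphism $p:F\to A$; for $x:U\to A$ write $\llbracket x\rrbracket=U\times_A F$ (pullback of $x$ and $p$) and $p_x:\llbracket x\rrbracket\to U$ for the projection; (3) a morphism $1_F:*\to F$; put $1_A=p\circ 1_F$; (4) for every $x:U\to A$ a function $\sum^{x}:\mathrm{Hom}(\llbracket x\rrbracket,A)\to\mathrm{Hom}(U,A)$, natural in the sense that for $h:U\to U'$ and $y:U'\to A$ with $y\circ h=x$ one has $\sum^{x}(g\circ(h\times_A \mathrm{id}_F))=(\sum^{y}g)\circ h$ for all $g:\llbracket y\rrbracket\to A$; (5) for every $x:U\to A$ and $f:\llbracket x\rrbracket\to A$ a morphism $f^\flat:\llbracket f\rrbracket\to\llbracket\sum^{x}f\rrbracket$ with $p_{\sum^x f}\circ f^\flat=p_x\circ p_f$. The axioms are, for all $x:U\to A$, $f:\llbracket x\rrbracket\to A$, $g:\llbracket\sum^x f\rrbracket\to A$, writing $const_{1_A}:\llbracket x\rrbracket\to *\to A$ for the constant $1_A$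 map: (Right Unit) $\sum^{x}const_{1_A}=x$; (Left Unit) $\sum^{const_{1_A}}(f\circ const_{1_A}^\flat)=f$; (Sum Associativity) $\sum^{\sum^x f}g=\sum^x\sum^f(g\circ f^\flat)$; (Flatten Associativity) $g^\flat\circ(f^\flat\times_A\mathrm{id}_F)=\big(\sum^f(g\circ f^\flat)\big)^\flat\circ(g\circ f^\flat)^\flat$ as morphisms $\llbracket g\circ f^\flat\rrbracket\to\llbracket\sum^x\sum^f(g\circ f^\flat)\rrbracket$. It is commutative if for all $x,y:U\to A$ and $f:\llbracket x\circ p_y\rrbracket\to A$ one has $\sum^{y}\sum^{x\circ p_y}f=\sum^{x}\sum^{y\circ p_x}(f\circ switch)$, where $switch$ is the canonical isomorphism between $\llbracket y\circ p_x\rrbracket$ and $\llbracket x\circ p_y\rrbracket$ (interchanging the two factors $F$). *)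

theory Defs
  imports
    "HOL-Analysis.Analysis"
    "HOL-Algebra.Ring"
    "HOL-Computational_Algebra.Primes"
begin

section \<open>Categories with finite limits\<close>

record ('o, 'm) category =
  Obj :: "'o set"
  Arr :: "'m set"
  Dom :: "'m \<Rightarrow> 'o"
  Cod :: "'m \<Rightarrow> 'o"
  Idn :: "'o \<Rightarrow> 'm"
  Cmp :: "'m \<Rightarrow> 'm \<Rightarrow> 'm"  (infixr "\<cdot>\<index>" 70)

definition Hom :: "('o, 'm) category \<Rightarrow> 'o \<Rightarrow> 'o \<Rightarrow> 'm set" where
  "Hom C X Y = {f \<in> Arr C. Dom C f = X \<and> Cod C f = Y}"

locale category =
  fixes C :: "('o, 'm) category" (structure)
  assumes Dom_Obj: "f \<in> Arr C \<Longrightarrow> Dom C f \<in> Obj C"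
    and Cod_Obj: "f \<in> Arr C \<Longrightarrow> Cod C f \<in> Obj C"
    and Idn_Hom: "X \<in> Obj C \<Longrightarrow> Idn C X \<in> Hom C X X"
    and Cmp_Hom: "\<lbrakk>f \<in> Hom C X Y; g \<in> Hom C Y Z\<rbrakk> \<Longrightarrow> g \<cdot> f \<in> Hom C X Z"
    and Cmp_Idn: "f \<in> Hom C X Y \<Longrightarrow> f \<cdot> Idn C X = f"
    and Idn_Cmp: "f \<in> Hom C X Y \<Longrightarrow> Idn C Y \<cdot> f = f"
    and Cmp_assoc: "\<lbrakk>f \<in> Hom C W X; g \<in> Hom C X Y; h \<in> Hom C Y Z\<rbrakk>
                      \<Longrightarrow> h \<cdot> (g \<cdot> f) = (h \<cdot> g) \<cdot> f"

locale finite_category = category J for J :: "('i, 'j) category" +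
  assumes finite_Obj: "finite (Obj J)"
    and finite_Arr: "finite (Arr J)"

locale diagram = J: category J + C: category C
  for J :: "('i, 'j) category" and C :: "('o, 'm) category" +
  fixes Fo :: "'i \<Rightarrow> 'o" and Fa :: "'j \<Rightarrow> 'm"
  assumes Fo_Obj: "i \<in> Obj J \<Longrightarrow> Fo i \<in> Obj C"
    and Fa_Hom: "a \<in> Hom J i j \<Longrightarrow> Fa a \<in> Hom C (Fo i) (Fo j)"
    and Fa_Idn: "i \<in> Obj J \<Longrightarrow> Fa (Idn J i) = Idn C (Fo i)"
    and Fa_Cmp: "\<lbrakk>a \<in> Hom J i j; b \<in> Hom J j k\<rbrakk>
                   \<Longrightarrow> Fa (b \<cdot>\<^bsub>J\<^esub> a) = Fa b \<cdot>\<^bsub>C\<^esub> Fa a"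

definition is_cone ::
  "('i, 'j) category \<Rightarrow> ('o, 'm) category \<Rightarrow> ('i \<Rightarrow> 'o) \<Rightarrow> ('j \<Rightarrow> 'm) \<Rightarrow> 'o \<Rightarrow> ('i \<Rightarrow> 'm) \<Rightarrow> bool"
where
  "is_cone J C Fo Fa L l \<longleftrightarrow>
     L \<in> Obj C \<and> (\<forall>i\<in>Obj J. l i \<in> Hom C L (Fo i)) \<and>
     (\<forall>a\<in>Arr J. Fa a \<cdot>\<^bsub>C\<^esub> l (Dom J a) = l (Cod J a))"

definition is_limit ::
  "('i, 'j) category \<Rightarrow> ('o, 'm) category \<Rightarrow> ('i \<Rightarrow> 'o) \<Rightarrow> ('j \<Rightarrow> 'm) \<Rightarrow> 'o \<Rightarrow> ('i \<Rightarrow> 'm) \<Rightarrow> bool"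
where
  "is_limit J C Fo Fa L l \<longleftrightarrow>
     is_cone J C Fo Fa L l \<and>
     (\<forall>X k. is_cone J C Fo Fa X k \<longrightarrow>
        (\<exists>!h. h \<in> Hom C X L \<and> (\<forall>i\<in>Obj J. l i \<cdot>\<^bsub>C\<^esub> h = k i)))"

text \<open>Every finite category is isomorphic to one whose objects and arrows are natural numbers,
  so quantifying over index categories of this type covers all finite diagrams.\<close>

locale finitely_complete_category = category C for C :: "('o, 'm) category" (structure) +
  assumes finite_limits:
    "\<lbrakk>finite_category (J :: (nat, nat) category); diagram J C Fo Fa\<rbrakk>
       \<Longrightarrow> \<exists>L l. is_limit J C Fo Fa L l"

definition is_terminal :: "('o, 'm) category \<Rightarrow> 'o \<Rightarrow> bool" where
  "is_terminal C T \<longleftrightarrow> T \<in> Obj C \<and> (\<forall>X\<in>Obj C. \<exists>!f. f \<in> Hom C X T)"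

definition is_pullback ::
  "('o, 'm) category \<Rightarrow> 'm \<Rightarrow> 'm \<Rightarrow> 'o \<Rightarrow> 'm \<Rightarrow> 'm \<Rightarrow> bool"
where
  "is_pullback C f g P p1 p2 \<longleftrightarrow>
     P \<in> Obj C \<and> p1 \<in> Hom C P (Dom C f) \<and> p2 \<in> Hom C P (Dom C g) \<and>
     f \<cdot>\<^bsub>C\<^esub> p1 = g \<cdot>\<^bsub>C\<^esub> p2 \<and>
     (\<forall>X\<in>Obj C. \<forall>a\<in>Hom C X (Dom C f). \<forall>b\<in>Hom C X (Dom C g).
        f \<cdot>\<^bsub>C\<^esub> a = g \<cdot>\<^bsub>C\<^esub> b \<longrightarrow>
        (\<exists>!h. h \<in> Hom C X P \<and> p1 \<cdot>\<^bsub>C\<^esub> h = a \<and> p2 \<cdot>\<^bsub>C\<^esub> h = b))"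


section \<open>Dependent adders\<close>

text \<open>Pullbacks are only determined up to isomorphism, so the choice of the pullbacks of
  \<open>p : F \<rightarrow> A\<close> is part of the data: \<open>Ext x\<close> is the object \<open>\<lbrakk>x\<rbrakk> = U \<times>\<^sub>A F\<close>, \<open>prj x\<close> its projection
  \<open>p\<^sub>x\<close> to \<open>U\<close> and \<open>prF x\<close> its projection to \<open>F\<close>.

  The morphisms \<open>\<Sum>\<^sup>x g\<close> and \<open>f\<^sup>\<flat>\<close> are written \<open>Sig x g\<close> and \<open>Flat x f\<close>. The argument \<open>x\<close> of
  \<open>Flat\<close> is needed because \<open>\<lbrakk>x\<rbrakk>\<close>, the domain of \<open>f\<close>, need not determine \<open>x\<close>.\<close>

record ('o, 'm) adder =
  A\<^sub>D :: 'o
  F\<^sub>D :: 'o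
  T\<^sub>D :: 'o
  p\<^sub>D :: 'm
  oneF :: 'm
  Ext :: "'m \<Rightarrow> 'o"
  prj :: "'m \<Rightarrow> 'm"
  prF :: "'m \<Rightarrow> 'm"
  Sig :: "'m \<Rightarrow> 'm \<Rightarrow> 'm"
  Flat :: "'m \<Rightarrow> 'm \<Rightarrow> 'm"

definition over :: "('o, 'm) category \<Rightarrow> ('o, 'm) adder \<Rightarrow> 'm set" where
  "over C D = {x \<in> Arr C. Cod C x = A\<^sub>D D}"

definition oneA :: "('o, 'm) category \<Rightarrow> ('o, 'm) adder \<Rightarrow> 'm" where
  "oneA C D = p\<^sub>D D \<cdot>\<^bsub>C\<^esub> oneF D"

definition const_one :: "('o, 'm) category \<Rightarrow> ('o, 'm) adder \<Rightarrow> 'o \<Rightarrow> 'm" where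
  "const_one C D X = oneA C D \<cdot>\<^bsub>C\<^esub> (THE t. t \<in> Hom C X (T\<^sub>D D))"

text \<open>\<open>times_F C D h x y\<close> is \<open>h \<times>\<^sub>A id\<^sub>F : \<lbrakk>x\<rbrakk> \<rightarrow> \<lbrakk>y\<rbrakk>\<close>, for \<open>y \<circ> h = x\<close>.\<close>

definition times_F :: "('o, 'm) category \<Rightarrow> ('o, 'm) adder \<Rightarrow> 'm \<Rightarrow> 'm \<Rightarrow> 'm \<Rightarrow> 'm" where
  "times_F C D h x y =
     (THE k. k \<in> Hom C (Ext D x) (Ext D y) \<and>
             prj D y \<cdot>\<^bsub>C\<^esub> k = h \<cdot>\<^bsub>C\<^esub> prj D x \<and>
             prF D y \<cdot>\<^bsub>C\<^esub> k = prF D x)"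

text \<open>The isomorphism \<open>\<lbrakk>y \<circ> p\<^sub>x\<rbrakk> \<rightarrow> \<lbrakk>x \<circ> p\<^sub>y\<rbrakk>\<close> over \<open>U\<close> interchanging the two factors \<open>F\<close>.\<close>

definition switch :: "('o, 'm) category \<Rightarrow> ('o, 'm) adder \<Rightarrow> 'm \<Rightarrow> 'm \<Rightarrow> 'm" where
  "switch C D x y =
     (let xy = x \<cdot>\<^bsub>C\<^esub> prj D y; yx = y \<cdot>\<^bsub>C\<^esub> prj D x in
      THE k. k \<in> Hom C (Ext D yx) (Ext D xy) \<and>
             prj D y \<cdot>\<^bsub>C\<^esub> (prj D xy \<cdot>\<^bsub>C\<^esub> k) = prj D x \<cdot>\<^bsub>C\<^esub> prj D yx \<and>
             prF D xy \<cdot>\<^bsub>C\<^esub> k = prF D x \<cdot>\<^bsub>C\<^esub> prj D yx \<and>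
             prF D y \<cdot>\<^bsub>C\<^esub> (prj D xy \<cdot>\<^bsub>C\<^esub> k) = prF D yx)"

locale dependent_adder = finitely_complete_category C
  for C :: "('o, 'm) category" (structure) +
  fixes D :: "('o, 'm) adder"
  assumes terminal: "is_terminal C (T\<^sub>D D)"
    and A_Obj: "A\<^sub>D D \<in> Obj C"
    and p_Hom: "p\<^sub>D D \<in> Hom C (F\<^sub>D D) (A\<^sub>D D)"
    and oneF_Hom: "oneF D \<in> Hom C (T\<^sub>D D) (F\<^sub>D D)"
    and pullback: "x \<in> over C D \<Longrightarrow> is_pullback C x (p\<^sub>D D) (Ext D x) (prj D x) (prF D x)"
    and Sig_Hom: "\<lbrakk>x \<in> Hom C U (A\<^sub>D D); g \<in> Hom C (Ext D x) (A\<^sub>D D)\<rbrakk>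
        \<Longrightarrow> Sig D x g \<in> Hom C U (A\<^sub>D D)"
    and Sig_natural: "\<lbrakk>h \<in> Hom C U U'; y \<in> Hom C U' (A\<^sub>D D); y \<cdot> h = x;
                       g \<in> Hom C (Ext D y) (A\<^sub>D D)\<rbrakk>
        \<Longrightarrow> Sig D x (g \<cdot> times_F C D h x y) = Sig D y g \<cdot> h"
    and Flat_Hom: "\<lbrakk>x \<in> over C D; f \<in> Hom C (Ext D x) (A\<^sub>D D)\<rbrakk>
        \<Longrightarrow> Flat D x f \<in> Hom C (Ext D f) (Ext D (Sig D x f))"
    and prj_Flat: "\<lbrakk>x \<in> over C D; f \<in> Hom C (Ext D x) (A\<^sub>D D)\<rbrakk>
        \<Longrightarrow> prj D (Sig D x f) \<cdot> Flat D x f = prj D x \<cdot> prj D f"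
    and right_unit: "x \<in> over C D \<Longrightarrow> Sig D x (const_one C D (Ext D x)) = x"
    and left_unit: "\<lbrakk>x \<in> over C D; f \<in> Hom C (Ext D x) (A\<^sub>D D); c = const_one C D (Ext D x)\<rbrakk>
        \<Longrightarrow> Sig D c (f \<cdot> Flat D x c) = f"
    and Sig_assoc: "\<lbrakk>x \<in> over C D; f \<in> Hom C (Ext D x) (A\<^sub>D D);
                     g \<in> Hom C (Ext D (Sig D x f)) (A\<^sub>D D)\<rbrakk>
        \<Longrightarrow> Sig D (Sig D x f) g = Sig D x (Sig D f (g \<cdot> Flat D x f))"
    and Flat_assoc: "\<lbrakk>x \<in> over C D; f \<in> Hom C (Ext D x) (A\<^sub>D D);
                      g \<in> Hom C (Ext D (Sig D x f)) (A\<^sub>D D); g' = g \<cdot> Flat D x f\<rbrakk>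
        \<Longrightarrow> Flat D (Sig D x f) g \<cdot> times_F C D (Flat D x f) g' g
            = Flat D x (Sig D f g') \<cdot> Flat D f g'"

locale commutative_dependent_adder = dependent_adder +
  assumes commutative: "\<lbrakk>x \<in> Hom C U (A\<^sub>D D); y \<in> Hom C U (A\<^sub>D D);
                         f \<in> Hom C (Ext D (x \<cdot> prj D y)) (A\<^sub>D D)\<rbrakk>
        \<Longrightarrow> Sig D y (Sig D (x \<cdot> prj D y) f)
            = Sig D x (Sig D (y \<cdot> prj D x) (f \<cdot> switch C D x y))"


section \<open>Metrizable spaces\<close>

text \<open>A morphism carries its domain and codomain; its underlying function is normalised to be
  \<^const>\<open>undefined\<close> outside the domain, so that equality of morphisms is equality of maps.\<close>

datatype 'x tmap = TMap (tdom: "'x topology") (tcod: "'x topology") (tfun: "'x \<Rightarrow> 'x")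

definition mk_tmap :: "'x topology \<Rightarrow> 'x topology \<Rightarrow> ('x \<Rightarrow> 'x) \<Rightarrow> 'x tmap" where
  "mk_tmap X Y f = TMap X Y (restrict f (topspace X))"

definition Top_mtr :: "('x topology, 'x tmap) category" where
  "Top_mtr = \<lparr>
     Obj = {X. metrizable_space X},
     Arr = {TMap X Y f | X Y f. metrizable_space X \<and> metrizable_space Y \<and>
              continuous_map X Y f \<and> f \<in> extensional (topspace X)},
     Dom = tdom,
     Cod = tcod,
     Idn = (\<lambda>X. mk_tmap X X (\<lambda>u. u)),
     Cmp = (\<lambda>g f. mk_tmap (tdom f) (tcod g) (tfun g \<circ> tfun f)) \<rparr>"

text \<open>The category \<^const>\<open>Top_mtr\<close> consists of the spaces whose points lie in a fixed type. The type
  below plays the role of the universe of points: it contains the elements of an arbitrary type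
  \<open>'a\<close> and the sequences representing \<open>q\<close>-adic integers, and it is closed under pairing.\<close>

datatype 'a point =
    Star
  | Atom 'a
  | Padic (padic: "nat \<Rightarrow> int")
  | Pair (pfst: "'a point") (psnd: "'a point")

definition star_space :: "'a point topology" where
  "star_space = discrete_topology {Star}"

definition times_space :: "'a point topology \<Rightarrow> 'a point topology \<Rightarrow> 'a point topology"
  (infixr "\<otimes>\<^sub>T" 80) where
  "X \<otimes>\<^sub>T Y = pullback_topology {Pair u v | u v. True} (\<lambda>w. (pfst w, psnd w)) (prod_topology X Y)"


section \<open>The q-adic integers\<close>

text \<open>\<open>\<int>\<^sub>q\<close> is the inverse limit of the rings \<open>\<int>/q\<^sup>n\<int>\<close>: the \<open>n\<close>-th term of a sequence in the carrier
  is the residue modulo \<open>q\<^sup>n\<close>, represented in \<open>{0..<q\<^sup>n}\<close>. The \<open>q\<close>-adic topology is the inverse limit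
  topology.\<close>

definition Zq :: "nat \<Rightarrow> (nat \<Rightarrow> int) ring" where
  "Zq q = \<lparr>
     carrier = {a. \<forall>n. a n \<in> {0..<int q ^ n} \<and> a (Suc n) mod int q ^ n = a n},
     mult = (\<lambda>a b n. (a n * b n) mod int q ^ n),
     one = (\<lambda>n. 1 mod int q ^ n),
     zero = (\<lambda>n. 0),
     add = (\<lambda>a b n. (a n + b n) mod int q ^ n) \<rparr>"

definition Zq_topology :: "nat \<Rightarrow> (nat \<Rightarrow> int) topology" where
  "Zq_topology q =
     subtopology (product_topology (\<lambda>_. discrete_topology UNIV) UNIV) (carrier (Zq q))"

definition Zq_of_nat :: "nat \<Rightarrow> nat \<Rightarrow> (nat \<Rightarrow> int)" where
  "Zq_of_nat q m = add_pow (Zq q) m \<one>\<^bsub>Zq q\<^esub>"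

text \<open>\<open>Zq_sum q f x\<close> is \<open>\<Sum>\<^sub>i\<^sub>=\<^sub>1\<^sup>x f(i)\<close>.\<close>

definition Zq_sum :: "nat \<Rightarrow> ((nat \<Rightarrow> int) \<Rightarrow> (nat \<Rightarrow> int)) \<Rightarrow> (nat \<Rightarrow> int) \<Rightarrow> (nat \<Rightarrow> int)" where
  "Zq_sum q f x =
     (THE s. \<forall>m :: nat \<Rightarrow> nat.
        limitin (Zq_topology q) (\<lambda>n. Zq_of_nat q (m n)) x sequentially \<longrightarrow>
        limitin (Zq_topology q) (\<lambda>n. \<Oplus>\<^bsub>Zq q\<^esub>i\<in>{1..m n}. f (Zq_of_nat q i)) s sequentially)"


section \<open>The dependent adder of q-adic integers\<close>

definition Zq_space :: "nat \<Rightarrow> 'a point topology" where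
  "Zq_space q = pullback_topology (range Padic) padic (Zq_topology q)"

text \<open>For a morphism \<open>x : U \<rightarrow> \<int>\<^sub>q\<close>, the pullback \<open>\<lbrakk>x\<rbrakk>\<close> is \<open>U \<times> \<int>\<^sub>q\<close> with the projections
  \<open>(u,t) \<mapsto> u\<close> and \<open>(u,t) \<mapsto> (t, x(u))\<close>.\<close>

definition Zq_adder :: "nat \<Rightarrow> ('a point topology, 'a point tmap) adder" where
  "Zq_adder q = (let Z = Zq_space q; one = Padic \<one>\<^bsub>Zq q\<^esub> in \<lparr>
     A\<^sub>D = Z,
     F\<^sub>D = Z \<otimes>\<^sub>T Z,
     T\<^sub>D = star_space,
     p\<^sub>D = mk_tmap (Z \<otimes>\<^sub>T Z) Z psnd,
     oneF = mk_tmap star_space (Z \<otimes>\<^sub>T Z) (\<lambda>_. Pair one one),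
     Ext = (\<lambda>x. tdom x \<otimes>\<^sub>T Z),
     prj = (\<lambda>x. mk_tmap (tdom x \<otimes>\<^sub>T Z) (tdom x) pfst),
     prF = (\<lambda>x. mk_tmap (tdom x \<otimes>\<^sub>T Z) (Z \<otimes>\<^sub>T Z) (\<lambda>w. Pair (psnd w) (tfun x (pfst w)))),
     Sig = (\<lambda>x f. mk_tmap (tdom x) Z
       (\<lambda>u. Padic (Zq_sum q (\<lambda>i. padic (tfun f (Pair u (Padic i)))) (padic (tfun x u))))),
     Flat = (\<lambda>x f. mk_tmap ((tdom x \<otimes>\<^sub>T Z) \<otimes>\<^sub>T Z) (tdom x \<otimes>\<^sub>T Z)
       (\<lambda>w. let u = pfst (pfst w); i = padic (psnd (pfst w)); j = padic (psnd w) in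
          Pair u (Padic (j \<oplus>\<^bsub>Zq q\<^esub>
            Zq_sum q (\<lambda>k. padic (tfun f (Pair u (Padic k)))) (i \<ominus>\<^bsub>Zq q\<^esub> \<one>\<^bsub>Zq q\<^esub>))))) \<rparr>)"

end

theory Submission
  imports Defs
begin

text \<open>
  Everything rests on one fact about summation over \<open>\<int>\<^sub>q\<close>. If \<open>f : \<int>\<^sub>q \<rightarrow> \<int>\<^sub>q\<close> is continuous, then by
  compactness \<open>f\<close> modulo \<open>q\<^sup>n\<close> is periodic with some period \<open>q\<^sup>N\<close>, so \<open>q\<^sup>n\<close> full periods add up to
  a multiple of \<open>q\<^sup>n\<close>, and the partial sums modulo \<open>q\<^sup>n\<close> have period \<open>q\<^sup>N\<^sup>+\<^sup>n\<close> (\<open>partial_sum_cong\<close>).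
  Hence the sum \<open>S f x\<close> up to \<open>x \<in> \<int>\<^sub>q\<close> exists (\<open>Zq_sum_closed_level\<close>). Since the period can be chosen
  uniformly near a given parameter (\<open>uniform_modulus\<close>), \<open>S (f u) (x u)\<close> is continuous in \<open>u\<close> whenever
  \<open>f\<close> is jointly continuous and \<open>x\<close> is continuous (\<open>continuous_map_Zq_sum\<close>). This makes \<open>\<Sum>\<^sup>x f\<close> and \<open>f\<^sup>\<flat>\<close>
  morphisms.

  The function \<open>S f\<close> is the only continuous \<open>H\<close> with \<open>H 0 = 0\<close> and \<open>H (c + 1) = H c + f (c + 1)\<close>,
  because the natural numbers are dense (\<open>Zq_sum_unique\<close>). The familiar identities of finite sums
  therefore extend to \<open>\<int>\<^sub>q\<close>: splitting a range (\<open>Zq_sum_split\<close>), cutting a range into blocks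
  (\<open>Zq_sum_assoc\<close>) and exchanging two summations (\<open>Zq_sum_swap\<close>). Evaluated in the fibre over a point
  of \<open>U\<close>, the unit laws are \<open>S 1 x = x\<close> and \<open>S f 1 = f 1\<close>, the sum associativity law is the cutting into
  blocks, the flatten associativity law combines it with splitting, and commutativity is the exchange
  of summations.

  On the categorical side, limits of finite diagrams are subspaces of finite products, which are
  metrizable (\<open>finitely_complete_Top_mtr\<close>), and \<open>U \<times> \<int>\<^sub>q\<close> is the pullback because the second component of
  a point of \<open>F\<close> is forced to be \<open>x(u)\<close> (\<open>pullback_D\<close>).
\<close>

section \<open>Arithmetic and topology of the q-adic integers\<close>

locale qadic =
  fixes q :: nat
  assumes q_pos: "0 < q"
begin

abbreviation Z where "Z \<equiv> Zq q"
abbreviation T where "T \<equiv> Zq_topology q"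
abbreviation nat_Z where "nat_Z \<equiv> Zq_of_nat q"
abbreviation S where "S \<equiv> Zq_sum q"

lemma pow_pos [simp]: "0 < int q ^ n"
  using q_pos by simp

lemma carrier_iff: "a \<in> carrier Z \<longleftrightarrow> (\<forall>n. 0 \<le> a n \<and> a n < int q ^ n \<and> a (Suc n) mod int q ^ n = a n)"
  by (auto simp: Zq_def)

lemma mod_pow_pow: "m \<le> n \<Longrightarrow> b mod int q ^ n mod int q ^ m = b mod int q ^ m"
  by (simp add: le_imp_power_dvd mod_mod_cancel)

text \<open>The tower condition relates consecutive levels only; iterated, it makes every level a
  reduction of each higher one.\<close>

lemma level_mod:
  assumes "a \<in> carrier Z" "m \<le> n"
  shows "a n mod int q ^ m = a m"
  using assms(2)
proof (induction n rule: dec_induct)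
  case base
  then show ?case using assms(1) by (simp add: carrier_iff)
next
  case (step n)
  then show ?case
    using assms(1) mod_pow_pow[of m n "a (Suc n)"] by (simp add: carrier_iff)
qed

lemma level_self [simp]: "a \<in> carrier Z \<Longrightarrow> a n mod int q ^ n = a n"
  by (simp add: carrier_iff)

lemma level_eq_mono: "\<lbrakk>a \<in> carrier Z; b \<in> carrier Z; a n = b n; m \<le> n\<rbrakk> \<Longrightarrow> a m = b m"
  by (metis level_mod)

lemma add_level: "(a \<oplus>\<^bsub>Z\<^esub> b) n = (a n + b n) mod int q ^ n"
  and mult_level: "(a \<otimes>\<^bsub>Z\<^esub> b) n = (a n * b n) mod int q ^ n"
  and one_level: "\<one>\<^bsub>Z\<^esub> n = 1 mod int q ^ n"
  and zero_level: "\<zero>\<^bsub>Z\<^esub> n = 0"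
  by (simp_all add: Zq_def)

text \<open>For a sequence given by unreduced representatives \<open>c n\<close>, compatibility has to be checked on the
  representatives only.\<close>

lemma carrierI:
  assumes "\<And>n. c n mod int q ^ n = c' n" "\<And>n. c (Suc n) mod int q ^ n = c n mod int q ^ n"
  shows "c' \<in> carrier Z"
proof -
  have "c' (Suc n) mod int q ^ n = c' n" for n
    using assms mod_pow_pow[of n "Suc n" "c (Suc n)"] by (metis le_SucI order_refl)
  moreover have "0 \<le> c' n \<and> c' n < int q ^ n" for n
    by (metis assms(1) pow_pos pos_mod_bound pos_mod_sign)
  ultimately show ?thesis by (simp add: carrier_iff)
qed

lemma add_closed: "\<lbrakk>a \<in> carrier Z; b \<in> carrier Z\<rbrakk> \<Longrightarrow> a \<oplus>\<^bsub>Z\<^esub> b \<in> carrier Z"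
  by (rule carrierI[where c = "\<lambda>n. a n + b n"]) (auto simp: add_level carrier_iff intro: mod_add_cong)

lemma mult_closed: "\<lbrakk>a \<in> carrier Z; b \<in> carrier Z\<rbrakk> \<Longrightarrow> a \<otimes>\<^bsub>Z\<^esub> b \<in> carrier Z"
  by (rule carrierI[where c = "\<lambda>n. a n * b n"]) (auto simp: mult_level carrier_iff intro: mod_mult_cong)

lemma int_closed: "(\<lambda>n. k mod int q ^ n) \<in> carrier Z"
  by (rule carrierI[where c = "\<lambda>n. k"]) auto

lemma one_closed: "\<one>\<^bsub>Z\<^esub> \<in> carrier Z"
  using int_closed[of 1] by (simp add: Zq_def)

lemma zero_closed: "\<zero>\<^bsub>Z\<^esub> \<in> carrier Z"
  using int_closed[of 0] by (simp add: Zq_def)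

lemma neg_closed: "a \<in> carrier Z \<Longrightarrow> (\<lambda>n. (- a n) mod int q ^ n) \<in> carrier Z"
  by (rule carrierI[where c = "\<lambda>n. - a n"]) (auto simp: carrier_iff intro: mod_minus_cong)

lemma cring_Z: "cring Z"
proof (rule cringI)
  have inv: "\<exists>y\<in>carrier Z. y \<oplus>\<^bsub>Z\<^esub> x = \<zero>\<^bsub>Z\<^esub>" if "x \<in> carrier Z" for x
    by (rule bexI[of _ "\<lambda>n. (- x n) mod int q ^ n"])
       (simp_all add: fun_eq_iff add_level zero_level mod_simps neg_closed that)
  have add: "(x \<oplus>\<^bsub>Z\<^esub> y) \<oplus>\<^bsub>Z\<^esub> z = x \<oplus>\<^bsub>Z\<^esub> (y \<oplus>\<^bsub>Z\<^esub> z)" "x \<oplus>\<^bsub>Z\<^esub> y = y \<oplus>\<^bsub>Z\<^esub> x"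
      "x \<in> carrier Z \<Longrightarrow> \<zero>\<^bsub>Z\<^esub> \<oplus>\<^bsub>Z\<^esub> x = x" for x y z
    by (simp_all add: fun_eq_iff add_level zero_level mod_simps add.assoc) (simp add: add.commute)
  have mult: "(x \<otimes>\<^bsub>Z\<^esub> y) \<otimes>\<^bsub>Z\<^esub> z = x \<otimes>\<^bsub>Z\<^esub> (y \<otimes>\<^bsub>Z\<^esub> z)" "x \<otimes>\<^bsub>Z\<^esub> y = y \<otimes>\<^bsub>Z\<^esub> x"
      "x \<in> carrier Z \<Longrightarrow> \<one>\<^bsub>Z\<^esub> \<otimes>\<^bsub>Z\<^esub> x = x" for x y z
    by (simp_all add: fun_eq_iff mult_level one_level mod_simps mult.assoc) (simp add: mult.commute)
  show "abelian_group Z"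
    by (rule abelian_groupI) (rule add inv add_closed zero_closed; assumption)+
  show "comm_monoid Z"
    by (rule comm_monoidI) (rule mult mult_closed one_closed; assumption)+
  show "(x \<oplus>\<^bsub>Z\<^esub> y) \<otimes>\<^bsub>Z\<^esub> z = x \<otimes>\<^bsub>Z\<^esub> z \<oplus>\<^bsub>Z\<^esub> y \<otimes>\<^bsub>Z\<^esub> z" for x y z
    by (simp add: fun_eq_iff add_level mult_level mod_simps distrib_right)
qed

sublocale R: cring Z
  by (rule cring_Z)

lemma nat_Z_Suc: "nat_Z (Suc m) = nat_Z m \<oplus>\<^bsub>Z\<^esub> \<one>\<^bsub>Z\<^esub>"
  by (simp add: Zq_of_nat_def)

lemma nat_Z_0: "nat_Z 0 = \<zero>\<^bsub>Z\<^esub>"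
  by (simp add: Zq_of_nat_def)

lemma nat_Z_closed [simp]: "nat_Z m \<in> carrier Z"
  by (simp add: Zq_of_nat_def)

lemma nat_Z_level: "nat_Z m n = int m mod int q ^ n"
  by (induction m) (simp_all add: nat_Z_0 nat_Z_Suc zero_level add_level one_level mod_simps add.commute)

lemma finsum_level:
  assumes "finite A" "g \<in> A \<rightarrow> carrier Z"
  shows "(\<Oplus>\<^bsub>Z\<^esub>i\<in>A. g i) n = (\<Sum>i\<in>A. g i n) mod int q ^ n"
  using assms by (induction A rule: finite_induct) (auto simp: zero_level R.finsum_insert add_level mod_simps Pi_iff)

lemma topspace_T [simp]: "topspace T = carrier Z"
  by (simp add: Zq_topology_def)

text \<open>Residues are truncated consistently, so agreement modulo a single power of \<open>q\<close> describes a
  basic neighbourhood: the topology is given by congruences.\<close>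

lemma openin_cylinder: "openin T {b \<in> carrier Z. b n = c}"
proof -
  have "openin (product_topology (\<lambda>_. discrete_topology UNIV) UNIV) {b :: nat \<Rightarrow> int. b n = c}"
    using openin_continuous_map_preimage[OF continuous_map_product_projection[of n UNIV "\<lambda>_. discrete_topology UNIV"], of "{c}"]
    by simp
  then have "openin T ({b. b n = c} \<inter> carrier Z)"
    unfolding Zq_topology_def by (rule openin_subtopology_Int)
  then show ?thesis
    by (simp add: Collect_conj_eq Int_commute)
qed

lemma continuous_map_to_discrete_iff:
  "continuous_map X (discrete_topology UNIV) g \<longleftrightarrow>
     (\<forall>u\<in>topspace X. \<exists>V. openin X V \<and> u \<in> V \<and> (\<forall>v\<in>V. g v = g u))" (is "?a \<longleftrightarrow> ?b")
proof
  assume c: ?a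
  show ?b
  proof
    fix u assume u: "u \<in> topspace X"
    have "openin X {x \<in> topspace X. g x \<in> {g u}}"
      by (rule openin_continuous_map_preimage[OF c]) simp
    then show "\<exists>V. openin X V \<and> u \<in> V \<and> (\<forall>v\<in>V. g v = g u)"
      using u by (intro exI[of _ "{x \<in> topspace X. g x \<in> {g u}}"]) simp
  qed
next
  assume b: ?b
  have "openin X {x \<in> topspace X. g x \<in> W}" for W
  proof (subst openin_subopen, rule ballI)
    fix u assume u: "u \<in> {x \<in> topspace X. g x \<in> W}"
    then obtain V where V: "openin X V" "u \<in> V" "\<forall>v\<in>V. g v = g u" using b by blast
    have "v \<in> {x \<in> topspace X. g x \<in> W}" if "v \<in> V" for v
    proof -
      have "g v = g u" using V(3) that by (rule bspec)
      then show ?thesis using u that openin_subset[OF V(1)] by auto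
    qed
    then have "V \<subseteq> {x \<in> topspace X. g x \<in> W}" by blast
    with V(1,2) show "\<exists>V. openin X V \<and> u \<in> V \<and> V \<subseteq> {x \<in> topspace X. g x \<in> W}"
      by blast
  qed
  then show ?a
    by (simp add: continuous_map_def)
qed

text \<open>A map into the inverse limit is continuous when each of its residues is, and a residue takes
  values in a discrete space.\<close>

lemma continuous_into_T_iff:
  "continuous_map X T f \<longleftrightarrow> f \<in> topspace X \<rightarrow> carrier Z \<and>
     (\<forall>n. \<forall>u\<in>topspace X. \<exists>V. openin X V \<and> u \<in> V \<and> (\<forall>v\<in>V. f v n = f u n))"
proof -
  have "continuous_map X T f \<longleftrightarrow>
      (\<forall>n. continuous_map X (discrete_topology UNIV) (\<lambda>u. f u n)) \<and> f \<in> topspace X \<rightarrow> carrier Z"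
    by (simp only: Zq_topology_def continuous_map_in_subtopology continuous_map_componentwise_UNIV image_subset_iff_funcset)
  then show ?thesis
    by (simp only: continuous_map_to_discrete_iff conj_commute)
qed

lemma continuous_map_level:
  assumes "continuous_map X T f" "u \<in> topspace X"
  shows "\<exists>V. openin X V \<and> u \<in> V \<and> (\<forall>v\<in>V. f v n = f u n)"
  using assms unfolding continuous_into_T_iff by blast

text \<open>\<open>\<int>\<^sub>q\<close> is cut out of the compact product of the finite sets of residues by closed conditions.\<close>

lemma compact_T: "compact_space T"
proof -
  let ?P = "product_topology (\<lambda>_. discrete_topology UNIV) UNIV :: (nat \<Rightarrow> int) topology"
  let ?K = "PiE UNIV (\<lambda>n. {0..<int q ^ n})"
  have K: "compactin ?P ?K"
    by (simp add: compactin_PiE compactin_discrete_topology)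
  have cyl: "closedin ?P {b. b (Suc n) mod int q ^ n = b n}" for n
  proof -
    have c: "continuous_map ?P (discrete_topology UNIV) (\<lambda>b. b k)" for k
      by (rule continuous_map_product_projection) (rule UNIV_I)
    have "continuous_map ?P (discrete_topology UNIV) (\<lambda>b. b (Suc n) mod int q ^ n - b n)"
      unfolding continuous_map_to_discrete_iff
    proof
      fix u assume "u \<in> topspace ?P"
      define V where "V = {b \<in> topspace ?P. b (Suc n) \<in> {u (Suc n)}} \<inter> {b \<in> topspace ?P. b n \<in> {u n}}"
      have "openin ?P V"
        unfolding V_def by (intro openin_Int openin_continuous_map_preimage[OF c]) simp_all
      moreover have "u \<in> V" "\<forall>b\<in>V. b (Suc n) mod int q ^ n - b n = u (Suc n) mod int q ^ n - u n"
        by (auto simp: V_def)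
      ultimately show "\<exists>V. openin ?P V \<and> u \<in> V \<and>
          (\<forall>b\<in>V. b (Suc n) mod int q ^ n - b n = u (Suc n) mod int q ^ n - u n)" by blast
    qed
    then have "closedin ?P {b \<in> topspace ?P. b (Suc n) mod int q ^ n - b n \<in> {0}}"
      by (rule closedin_continuous_map_preimage) simp
    then show ?thesis by simp
  qed
  have "closedin ?P ?K"
    by (simp add: closedin_product_topology)
  moreover have eq: "carrier Z = ?K \<inter> (\<Inter>n. {b. b (Suc n) mod int q ^ n = b n})"
    by (auto simp: carrier_iff PiE_iff)
  moreover have "closedin ?P (\<Inter>n. {b. b (Suc n) mod int q ^ n = b n})"
    using cyl by (intro closedin_INT) simp_all
  ultimately have "closedin ?P (carrier Z)"
    unfolding eq by (intro closedin_Int)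
  then have "compactin ?P (carrier Z)"
    by (rule closed_compactin[OF K, rotated]) (unfold eq, rule Int_lower1)
  then show ?thesis
    unfolding Zq_topology_def by (rule compact_space_subtopology)
qed

text \<open>This is where compactness of \<open>\<int>\<^sub>q\<close> enters: one modulus \<open>q\<^sup>N\<close> works for all second arguments
  and for all parameters near \<open>u\<close>. For a parameter space with one point it is uniform
  continuity.\<close>

lemma uniform_modulus:
  assumes f: "continuous_map (prod_topology X T) T (\<lambda>(u, i). f u i)" and u: "u \<in> topspace X"
  obtains V N where "openin X V" "u \<in> V"
    "\<And>v i j. \<lbrakk>v \<in> V; i \<in> carrier Z; j \<in> carrier Z; i N = j N\<rbrakk> \<Longrightarrow> f v i n = f u j n"
proof -
  have "\<exists>V N. i \<in> carrier Z \<longrightarrow> openin X V \<and> u \<in> V \<and>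
      (\<forall>v\<in>V. \<forall>j\<in>carrier Z. j N = i N \<longrightarrow> f v j n = f u i n)" for i
  proof (cases "i \<in> carrier Z")
    case i: True
    have "\<exists>W. openin (prod_topology X T) W \<and> (u, i) \<in> W \<and>
        (\<forall>w\<in>W. (\<lambda>(u, i). f u i) w n = (\<lambda>(u, i). f u i) (u, i) n)"
      by (rule continuous_map_level[OF f]) (simp add: u i)
    then obtain W where W: "openin (prod_topology X T) W" "(u, i) \<in> W"
      and eq: "\<forall>w\<in>W. (\<lambda>(u, i). f u i) w n = (\<lambda>(u, i). f u i) (u, i) n"
      by blast
    from W(1)[unfolded openin_prod_topology_alt, rule_format, OF W(2)]
    obtain V B where VB: "openin X V" "openin T B" "u \<in> V" "i \<in> B" "V \<times> B \<subseteq> W"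
      by (elim exE conjE)
    have B: "\<exists>N. \<forall>j\<in>carrier Z. j N = i N \<longrightarrow> j \<in> B"
    proof -
      obtain O' where O': "openin (product_topology (\<lambda>_. discrete_topology UNIV) UNIV) O'" "B = O' \<inter> carrier Z"
        using VB(2) unfolding Zq_topology_def openin_subtopology by blast
      have "i \<in> O'" using VB(4) O'(2) by blast
      then obtain U where "finite {k \<in> UNIV. U k \<noteq> topspace (discrete_topology (UNIV :: int set))}"
          and U: "i \<in> PiE UNIV U" "PiE UNIV U \<subseteq> O'"
        using O'(1)[unfolded openin_product_topology_alt] by meson
      then have "finite {k. U k \<noteq> UNIV}" by simp
      then obtain N where N: "\<forall>k\<in>{k. U k \<noteq> UNIV}. k \<le> N"
        unfolding finite_nat_set_iff_bounded_le by blast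
      have "j \<in> B" if j: "j \<in> carrier Z" "j N = i N" for j
      proof -
        have "j k \<in> U k" for k
        proof (cases "U k = UNIV")
          case False
          then have "j k = i k" using N level_eq_mono[OF j(1) i j(2), of k] by blast
          then show ?thesis using U(1) by (simp add: PiE_iff)
        qed simp
        then have "j \<in> PiE UNIV U" by (simp add: PiE_iff)
        then show ?thesis using U(2) O'(2) j(1) by blast
      qed
      then show ?thesis by blast
    qed
    then obtain N where N: "\<forall>j\<in>carrier Z. j N = i N \<longrightarrow> j \<in> B" by blast
    have "f v j n = f u i n" if "v \<in> V" "j \<in> carrier Z" "j N = i N" for v j
    proof -
      have "(v, j) \<in> W" using VB(5) N that by blast
      from bspec[OF eq this] show ?thesis by simp
    qed
    then show ?thesis using VB(1,3) by blast
  qed simp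
  then obtain V where "\<forall>i. \<exists>N. i \<in> carrier Z \<longrightarrow> openin X (V i) \<and> u \<in> V i \<and>
      (\<forall>v\<in>V i. \<forall>j\<in>carrier Z. j N = i N \<longrightarrow> f v j n = f u i n)"
    by (rule choice[OF allI, THEN exE])
  then obtain N where VN: "\<forall>i. i \<in> carrier Z \<longrightarrow> openin X (V i) \<and> u \<in> V i \<and>
      (\<forall>v\<in>V i. \<forall>j\<in>carrier Z. j (N i) = i (N i) \<longrightarrow> f v j n = f u i n)"
    by (rule choice[THEN exE])
  have Vo: "openin X (V i)" and Vu: "u \<in> V i" if "i \<in> carrier Z" for i
    using VN that by blast+
  have VNeq: "f v j n = f u i n"
    if "i \<in> carrier Z" "v \<in> V i" "j \<in> carrier Z" "j (N i) = i (N i)" for i v j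
    using VN that by blast
  \<comment> \<open>Finitely many cylinders cover \<open>\<int>\<^sub>q\<close>; the largest of their levels refines all of them.\<close>
  let ?C = "\<lambda>i. {j \<in> carrier Z. j (N i) = i (N i)}"
  have "\<forall>C\<in>?C ` carrier Z. openin T C"
    by (intro ballI, elim imageE, hypsubst, rule openin_cylinder)
  moreover have "topspace T \<subseteq> \<Union>(?C ` carrier Z)"
    unfolding topspace_T by (intro subsetI UnionI, rule imageI) simp_all
  ultimately have "\<exists>\<F>. finite \<F> \<and> \<F> \<subseteq> ?C ` carrier Z \<and> topspace T \<subseteq> \<Union>\<F>"
    by (intro compact_T[unfolded compact_space_alt, THEN spec, THEN mp] conjI)
  then obtain \<F> where fin: "finite \<F>" and sub: "\<F> \<subseteq> ?C ` carrier Z" and \<F>: "topspace T \<subseteq> \<Union>\<F>"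
    by (elim exE conjE)
  obtain I where I: "I \<subseteq> carrier Z" "finite I" and "\<F> = ?C ` I"
    using finite_subset_image[OF fin sub] by (elim exE conjE)
  with \<F> have I3: "carrier Z \<subseteq> \<Union>(?C ` I)"
    by (simp only: topspace_T)
  have Ine: "I \<noteq> {}" using I3 R.zero_closed by blast
  define M where "M = Max (N ` I)"
  have M: "N i \<le> M" if "i \<in> I" for i
    using I(2) that by (simp add: M_def)
  show thesis
  proof
    show "openin X (\<Inter>(V ` I))"
    proof (rule openin_Inter)
      show "\<And>W. W \<in> V ` I \<Longrightarrow> openin X W" using Vo I(1) by blast
    qed (simp_all add: I(2) Ine)
    show "u \<in> \<Inter>(V ` I)" using Vu I(1) by blast
    fix v i j assume v: "v \<in> \<Inter>(V ` I)" and ij: "i \<in> carrier Z" "j \<in> carrier Z" "i M = j M"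
    obtain k where k: "k \<in> I" "j (N k) = k (N k)" using subsetD[OF I3 ij(2)] by blast
    then have "i (N k) = k (N k)" using level_eq_mono[OF ij M[OF k(1)]] by simp
    then have "f v i n = f u k n" using VNeq[of k v i] I(1) k(1) v ij(1) by blast
    moreover have "f u j n = f u k n" using VNeq[of k u j] Vu[of k] I(1) k ij(2) by blast
    ultimately show "f v i n = f u j n" by simp
  qed
qed

lemma uniform_modulus_single:
  assumes f: "continuous_map T T f"
  obtains N where "\<And>i j. \<lbrakk>i \<in> carrier Z; j \<in> carrier Z; i N = j N\<rbrakk> \<Longrightarrow> f i n = f j n"
proof -
  have "continuous_map (prod_topology (discrete_topology {()}) T) T (f \<circ> snd)"
    by (intro continuous_map_compose[OF _ f] continuous_map_snd)
  then have "continuous_map (prod_topology (discrete_topology {()}) T) T (\<lambda>(u, i). f i)"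
    by (simp add: comp_def case_prod_unfold)
  from uniform_modulus[OF this, of "()" n]
  obtain V N where "() \<in> V"
    "\<And>v i j. \<lbrakk>v \<in> V; i \<in> carrier Z; j \<in> carrier Z; i N = j N\<rbrakk> \<Longrightarrow> f i n = f j n"
    by (metis singletonI topspace_discrete_topology)
  then show thesis using that by blast
qed

lemma nat_approx:
  assumes "x \<in> carrier Z"
  shows "int (nat (x n)) mod int q ^ n = x n"
  using assms by (simp add: carrier_iff)

text \<open>The natural numbers are dense in \<open>\<int>\<^sub>q\<close>.\<close>

lemma continuous_eq_on_nat:
  assumes f: "continuous_map T T f" and g: "continuous_map T T g"
    and eq: "\<And>m. f (nat_Z m) = g (nat_Z m)" and x: "x \<in> carrier Z"
  shows "f x = g x"
proof
  fix n
  obtain N where N: "\<And>i j. \<lbrakk>i \<in> carrier Z; j \<in> carrier Z; i N = j N\<rbrakk> \<Longrightarrow> f i n = f j n"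
    by (rule uniform_modulus_single[OF f, where n = n], rule that)
  obtain M where M: "\<And>i j. \<lbrakk>i \<in> carrier Z; j \<in> carrier Z; i M = j M\<rbrakk> \<Longrightarrow> g i n = g j n"
    by (rule uniform_modulus_single[OF g, where n = n], rule that)
  define m where "m = nat (x (max N M))"
  have "nat_Z m (max N M) = x (max N M)" using nat_approx[OF x] by (simp only: nat_Z_level m_def)
  then have "x N = nat_Z m N" "x M = nat_Z m M"
    using level_eq_mono[OF x nat_Z_closed] by (metis max.cobounded1, metis max.cobounded2)
  then show "f x n = g x n" using N M x eq nat_Z_closed by metis
qed

end

section \<open>Summation over the q-adic integers\<close>

lemma sum_periodic:
  fixes c :: "nat \<Rightarrow> int"
  assumes "\<And>i. c (i + p) = c i"
  shows "(\<Sum>i=1..m + k * p. c i) = (\<Sum>i=1..m. c i) + int k * (\<Sum>i=1..p. c i)"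
proof -
  have *: "(\<Sum>i=1..m + p. c i) = (\<Sum>i=1..m. c i) + (\<Sum>i=1..p. c i)" for m
  proof (induction m)
    case (Suc m)
    then show ?case using assms[of "Suc m"] by simp
  qed simp
  show ?thesis
  proof (induction k)
    case (Suc k)
    have "m + Suc k * p = (m + k * p) + p" by simp
    then show ?case using Suc *[of "m + k * p"] by (simp only: int_Suc distrib_right)
  qed simp
qed

context qadic
begin

text \<open>If the residues of \<open>f\<close> modulo \<open>q\<^sup>n\<close> have period \<open>q\<^sup>N\<close>, then \<open>q\<^sup>n\<close> periods contribute a
  multiple of \<open>q\<^sup>n\<close>, so the partial sums modulo \<open>q\<^sup>n\<close> have period \<open>q\<^sup>N\<^sup>+\<^sup>n\<close>.\<close>

lemma partial_sum_cong:
  assumes N: "\<And>i j. \<lbrakk>i \<in> carrier Z; j \<in> carrier Z; i N = j N\<rbrakk> \<Longrightarrow> f i n = f j n"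
    and m: "int m mod int q ^ (N + n) = int m' mod int q ^ (N + n)"
  shows "(\<Sum>i=1..m. f (nat_Z i) n) mod int q ^ n = (\<Sum>i=1..m'. f (nat_Z i) n) mod int q ^ n"
proof -
  have *: "(\<Sum>i=1..b. f (nat_Z i) n) mod int q ^ n = (\<Sum>i=1..a. f (nat_Z i) n) mod int q ^ n"
    if le: "a \<le> b" and cong: "int b mod int q ^ (N + n) = int a mod int q ^ (N + n)" for a b
  proof -
    have "b mod q ^ (N + n) = a mod q ^ (N + n)"
      using cong by (simp flip: of_nat_power of_nat_mod)
    then obtain l where "b = a + q ^ (N + n) * l"
      using le by (rule mod_eq_nat1E)
    then have b: "b = a + (l * q ^ n) * q ^ N"
      by (simp add: power_add mult_ac)
    have "f (nat_Z (i + q ^ N)) n = f (nat_Z i) n" for i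
      by (rule N) (simp_all add: nat_Z_level)
    from sum_periodic[where c = "\<lambda>i. f (nat_Z i) n", OF this, of a "l * q ^ n"]
    have "(\<Sum>i=1..b. f (nat_Z i) n) = (\<Sum>i=1..a. f (nat_Z i) n) +
        int q ^ n * (int l * (\<Sum>i=1..q ^ N. f (nat_Z i) n))"
      unfolding b by (simp only: of_nat_mult of_nat_power mult_ac)
    then show ?thesis by (simp only: mod_mult_self2)
  qed
  show ?thesis
  proof (cases "m \<le> m'")
    case True
    from *[OF this m[symmetric]] show ?thesis by (rule sym)
  next
    case False
    then show ?thesis by (intro * m) simp
  qed
qed

lemma limitin_T_iff:
  "limitin T g l F \<longleftrightarrow>
     l \<in> carrier Z \<and> eventually (\<lambda>k. g k \<in> carrier Z) F \<and> (\<forall>n. eventually (\<lambda>k. g k n = l n) F)"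
proof -
  have "limitin (discrete_topology (UNIV :: int set)) h c F \<longleftrightarrow> eventually (\<lambda>k. h k = c) F"
    (is "?a \<longleftrightarrow> ?b") for h c
  proof
    assume ?a
    then have "openin (discrete_topology (UNIV :: int set)) {c} \<longrightarrow> c \<in> {c} \<longrightarrow> eventually (\<lambda>k. h k \<in> {c}) F"
      unfolding limitin_def by blast
    then show ?b by simp
  next
    assume b: ?b
    show ?a
      unfolding limitin_def by (auto intro: eventually_mono[OF b])
  qed
  then show ?thesis
    by (simp add: Zq_topology_def limitin_subtopology limitin_componentwise)
qed

text \<open>Uniqueness of the value that \<^const>\<open>Zq_sum\<close> describes is seen on one particular sequence of
  natural numbers converging to \<open>x\<close>, its truncations \<open>x k\<close>.\<close>

lemma Zq_sum_eqI:
  assumes f: "f \<in> carrier Z \<rightarrow> carrier Z" and x: "x \<in> carrier Z" and s: "s \<in> carrier Z"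
    and ev: "\<And>n. \<exists>K. \<forall>m. int m mod int q ^ K = x K \<longrightarrow>
               (\<Sum>i=1..m. f (nat_Z i) n) mod int q ^ n = s n"
  shows "S f x = s"
  unfolding Zq_sum_def
proof (rule the_equality)
  have fin: "(\<Oplus>\<^bsub>Z\<^esub>i\<in>{1..m}. f (nat_Z i)) \<in> carrier Z"
      "(\<Oplus>\<^bsub>Z\<^esub>i\<in>{1..m}. f (nat_Z i)) n = (\<Sum>i=1..m. f (nat_Z i) n) mod int q ^ n" for m :: nat and n
  proof -
    have "(\<lambda>i. f (nat_Z i)) \<in> {1..m} \<rightarrow> carrier Z" using f nat_Z_closed by blast
    then show "(\<Oplus>\<^bsub>Z\<^esub>i\<in>{1..m}. f (nat_Z i)) \<in> carrier Z"
      "(\<Oplus>\<^bsub>Z\<^esub>i\<in>{1..m}. f (nat_Z i)) n = (\<Sum>i=1..m. f (nat_Z i) n) mod int q ^ n"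
      by (simp_all add: finsum_level R.finsum_closed)
  qed
  have lim: "limitin T (\<lambda>k. \<Oplus>\<^bsub>Z\<^esub>i\<in>{1..m k}. f (nat_Z i)) s sequentially"
    if "limitin T (\<lambda>k. nat_Z (m k)) x sequentially" for m
    unfolding limitin_T_iff
  proof (intro conjI allI s)
    fix n
    obtain K where K: "\<forall>m. int m mod int q ^ K = x K \<longrightarrow>
               (\<Sum>i=1..m. f (nat_Z i) n) mod int q ^ n = s n"
      using ev by (rule exE)
    have "eventually (\<lambda>k. nat_Z (m k) K = x K) sequentially"
      using that unfolding limitin_T_iff by blast
    then show "eventually (\<lambda>k. (\<Oplus>\<^bsub>Z\<^esub>i\<in>{1..m k}. f (nat_Z i)) n = s n) sequentially"
      by (rule eventually_mono) (simp only: fin nat_Z_level K[rule_format])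
  next
    show "eventually (\<lambda>k. (\<Oplus>\<^bsub>Z\<^esub>i\<in>{1..m k}. f (nat_Z i)) \<in> carrier Z) sequentially"
      by (intro always_eventually allI fin)
  qed
  then show "\<forall>m. limitin T (\<lambda>k. nat_Z (m k)) x sequentially \<longrightarrow>
      limitin T (\<lambda>k. \<Oplus>\<^bsub>Z\<^esub>i\<in>{1..m k}. f (nat_Z i)) s sequentially"
    by blast
  fix s' assume s': "\<forall>m. limitin T (\<lambda>k. nat_Z (m k)) x sequentially \<longrightarrow>
      limitin T (\<lambda>k. \<Oplus>\<^bsub>Z\<^esub>i\<in>{1..m k}. f (nat_Z i)) s' sequentially"
  have "nat_Z (nat (x k)) n = x n" if "n \<le> k" for k n
    using nat_approx[OF x, of k] mod_pow_pow[OF that, of "int (nat (x k))"] level_mod[OF x that]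
    by (simp only: nat_Z_level)
  then have nl: "limitin T (\<lambda>k. nat_Z (nat (x k))) x sequentially"
    unfolding limitin_T_iff eventually_sequentially using x nat_Z_closed by blast
  have l: "limitin T (\<lambda>k. \<Oplus>\<^bsub>Z\<^esub>i\<in>{1..nat (x k)}. f (nat_Z i)) s' sequentially"
    by (rule s'[rule_format, OF nl])
  show "s' = s"
  proof
    fix n
    have "eventually (\<lambda>k. (\<Oplus>\<^bsub>Z\<^esub>i\<in>{1..nat (x k)}. f (nat_Z i)) n = s' n) sequentially"
      using l unfolding limitin_T_iff by blast
    moreover have "eventually (\<lambda>k. (\<Oplus>\<^bsub>Z\<^esub>i\<in>{1..nat (x k)}. f (nat_Z i)) n = s n) sequentially"
      using lim[OF nl] unfolding limitin_T_iff by blast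
    ultimately have "eventually (\<lambda>k :: nat. s' n = s n) sequentially"
      by eventually_elim simp
    then show "s' n = s n" by simp
  qed
qed

lemma continuous_closed: "continuous_map T T f \<Longrightarrow> i \<in> carrier Z \<Longrightarrow> f i \<in> carrier Z"
  using continuous_map_image_subset_topspace[of T T f] by auto

lemma approx_eq:
  assumes "x \<in> carrier Z" "K \<le> L"
  shows "int (nat (x L)) mod int q ^ K = x K"
  using nat_approx[OF assms(1), of L] mod_pow_pow[OF assms(2), of "int (nat (x L))"] level_mod[OF assms]
  by simp

text \<open>The sum exists, and any modulus of continuity of \<open>f\<close> tells how far the upper limit has to be
  approximated.\<close>

lemma Zq_sum_closed_level:
  assumes f: "continuous_map T T f" and x: "x \<in> carrier Z"
  shows Zq_sum_closed: "S f x \<in> carrier Z"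
    and Zq_sum_level: "\<And>n N m. \<lbrakk>\<And>i j. \<lbrakk>i \<in> carrier Z; j \<in> carrier Z; i N = j N\<rbrakk> \<Longrightarrow> f i n = f j n;
       int m mod int q ^ (N + n) = x (N + n)\<rbrakk> \<Longrightarrow>
       S f x n = (\<Sum>i=1..m. f (nat_Z i) n) mod int q ^ n"
proof -
  let ?s = "\<lambda>m n. (\<Sum>i=1..m. f (nat_Z i) n) mod int q ^ n"
  have "\<exists>N. \<forall>i\<in>carrier Z. \<forall>j\<in>carrier Z. i N = j N \<longrightarrow> f i n = f j n" for n
  proof -
    obtain N where N: "\<And>i j. \<lbrakk>i \<in> carrier Z; j \<in> carrier Z; i N = j N\<rbrakk> \<Longrightarrow> f i n = f j n"
      by (rule uniform_modulus_single[OF f, where n = n], rule that)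
    show ?thesis by (rule exI[of _ N]) (intro ballI impI N)
  qed
  then obtain N where "\<forall>n. \<forall>i\<in>carrier Z. \<forall>j\<in>carrier Z. i (N n) = j (N n) \<longrightarrow> f i n = f j n"
    by (rule choice[OF allI, THEN exE])
  then have N: "\<And>n i j. \<lbrakk>i \<in> carrier Z; j \<in> carrier Z; i (N n) = j (N n)\<rbrakk> \<Longrightarrow> f i n = f j n"
    by blast
  define s where "s n = ?s (nat (x (N n + n))) n" for n
  have s: "?s m n = s n" if "int m mod int q ^ (N n + n) = x (N n + n)" for m n
    unfolding s_def
    by (rule partial_sum_cong[where N = "N n"], rule N) (simp_all only: that approx_eq[OF x order_refl])
  have s_carrier: "s \<in> carrier Z"
  proof (rule carrierI[where c = s])
    fix n
    show "s n mod int q ^ n = s n" by (simp add: s_def)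
    \<comment> \<open>One natural number that is close enough to \<open>x\<close> for the residues modulo \<open>q\<^sup>n\<close> and \<open>q\<^sup>n\<^sup>+\<^sup>1\<close>.\<close>
    define m where "m = nat (x (max (N n + n) (N (Suc n) + Suc n)))"
    have "s n = ?s m n" "s (Suc n) = ?s m (Suc n)"
      by (rule s[symmetric], simp only: m_def approx_eq[OF x] max.cobounded1 max.cobounded2)+
    moreover have "f (nat_Z i) (Suc n) mod int q ^ n = f (nat_Z i) n" for i
      using continuous_closed[OF f nat_Z_closed] by (simp add: carrier_iff)
    then have "(\<Sum>i=1..m. f (nat_Z i) (Suc n)) mod int q ^ n = ?s m n"
      using mod_sum_eq[of "\<lambda>i. f (nat_Z i) (Suc n)" "int q ^ n" "{1..m}"] by simp
    ultimately show "s (Suc n) mod int q ^ n = s n mod int q ^ n"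
      using mod_pow_pow[of n "Suc n"] by simp
  qed
  have eq: "S f x = s"
  proof (rule Zq_sum_eqI[OF _ x s_carrier])
    show "f \<in> carrier Z \<rightarrow> carrier Z" using continuous_closed[OF f] by blast
    show "\<exists>K. \<forall>m. int m mod int q ^ K = x K \<longrightarrow> ?s m n = s n" for n
      using s by blast
  qed
  show "S f x \<in> carrier Z" by (simp only: eq s_carrier)
  fix n M m
  assume M: "\<And>i j. \<lbrakk>i \<in> carrier Z; j \<in> carrier Z; i M = j M\<rbrakk> \<Longrightarrow> f i n = f j n"
    and m: "int m mod int q ^ (M + n) = x (M + n)"
  define k where "k = nat (x (max (N n + n) (M + n)))"
  have "S f x n = ?s k n"
    unfolding eq k_def by (rule s[symmetric], rule approx_eq[OF x max.cobounded1])
  also have "\<dots> = ?s m n"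
    by (rule partial_sum_cong[where N = M], rule M) (simp_all only: m k_def approx_eq[OF x] max.cobounded2)
  finally show "S f x n = ?s m n" .
qed

lemma Zq_sum_cong:
  assumes "\<And>i. i \<in> carrier Z \<Longrightarrow> f i = g i" "g \<in> carrier Z \<rightarrow> carrier Z"
  shows "S f x = S g x"
proof -
  have "(\<Oplus>\<^bsub>Z\<^esub>i\<in>{1..m}. f (nat_Z i)) = (\<Oplus>\<^bsub>Z\<^esub>i\<in>{1..m}. g (nat_Z i))" for m
    using assms nat_Z_closed by (intro R.finsum_cong') blast+
  then show ?thesis by (simp only: Zq_sum_def)
qed

lemma continuous_map_T_add:
  assumes "continuous_map X T f" "continuous_map X T g"
  shows "continuous_map X T (\<lambda>u. f u \<oplus>\<^bsub>Z\<^esub> g u)"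
  unfolding continuous_into_T_iff
proof (intro conjI allI ballI)
  show "(\<lambda>u. f u \<oplus>\<^bsub>Z\<^esub> g u) \<in> topspace X \<rightarrow> carrier Z"
    using assms unfolding continuous_into_T_iff by blast
  fix n u assume "u \<in> topspace X"
  then obtain V W where VW: "openin X V" "u \<in> V" "openin X W" "u \<in> W"
      and "\<forall>v\<in>V. f v n = f u n" "\<forall>v\<in>W. g v n = g u n"
    using continuous_map_level[OF assms(1), of u n] continuous_map_level[OF assms(2), of u n] by blast
  then have "\<forall>v\<in>V \<inter> W. (f v \<oplus>\<^bsub>Z\<^esub> g v) n = (f u \<oplus>\<^bsub>Z\<^esub> g u) n"
    unfolding add_level by (metis IntD1 IntD2)
  with VW show "\<exists>V. openin X V \<and> u \<in> V \<and> (\<forall>v\<in>V. (f v \<oplus>\<^bsub>Z\<^esub> g v) n = (f u \<oplus>\<^bsub>Z\<^esub> g u) n)"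
    by (intro exI[of _ "V \<inter> W"] conjI openin_Int IntI)
qed

lemma continuous_map_T_minus_one:
  assumes "continuous_map X T f"
  shows "continuous_map X T (\<lambda>u. f u \<ominus>\<^bsub>Z\<^esub> \<one>\<^bsub>Z\<^esub>)"
proof -
  have "\<ominus>\<^bsub>Z\<^esub> \<one>\<^bsub>Z\<^esub> \<in> topspace T" by simp
  then show ?thesis
    unfolding a_minus_def by (intro continuous_map_T_add assms) simp
qed

lemma continuous_section:
  assumes "continuous_map (prod_topology X T) T (\<lambda>(u, i). f u i)" "u \<in> topspace X"
  shows "continuous_map T T (f u)"
proof -
  have "continuous_map T T ((\<lambda>(u, i). f u i) \<circ> (\<lambda>i. (u, i)))"
    using assms by (intro continuous_map_compose[where X' = "prod_topology X T"] continuous_map_pairedI) simp_all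
  then show ?thesis by (simp add: comp_def)
qed

text \<open>By \<open>uniform_modulus\<close> all sections near \<open>u\<close> are congruent modulo \<open>q\<^sup>n\<close> to the section at \<open>u\<close> and
  share its modulus of continuity.\<close>

lemma continuous_map_Zq_sum:
  assumes f: "continuous_map (prod_topology X T) T (\<lambda>(u, i). f u i)" and x: "continuous_map X T x"
  shows "continuous_map X T (\<lambda>u. S (f u) (x u))"
  unfolding continuous_into_T_iff
proof (intro conjI allI ballI)
  have x_closed: "x u \<in> carrier Z" if "u \<in> topspace X" for u
    using x that unfolding continuous_into_T_iff by blast
  then show "(\<lambda>u. S (f u) (x u)) \<in> topspace X \<rightarrow> carrier Z"
    using Zq_sum_closed[OF continuous_section[OF f]] by blast
  fix n u assume u: "u \<in> topspace X"
  obtain V N where V: "openin X V" "u \<in> V"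
    and N: "\<And>v i j. \<lbrakk>v \<in> V; i \<in> carrier Z; j \<in> carrier Z; i N = j N\<rbrakk> \<Longrightarrow> f v i n = f u j n"
    by (rule uniform_modulus[OF f u, where n = n], rule that)
  obtain W where W: "openin X W" "u \<in> W" "\<forall>v\<in>W. x v (N + n) = x u (N + n)"
    using continuous_map_level[OF x u, of "N + n"] by (elim exE conjE)
  define m where "m = nat (x u (N + n))"
  have "S (f v) (x v) n = (\<Sum>i=1..m. f u (nat_Z i) n) mod int q ^ n" if v: "v \<in> V \<inter> W" for v
  proof -
    have vX: "v \<in> topspace X" using openin_subset[OF V(1)] v by blast
    have "S (f v) (x v) n = (\<Sum>i=1..m. f v (nat_Z i) n) mod int q ^ n"
    proof (rule Zq_sum_level[OF continuous_section[OF f vX] x_closed[OF vX], where N = N])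
      fix i j assume ij: "i \<in> carrier Z" "j \<in> carrier Z" "i N = j N"
      have "f v i n = f u j n" "f v j n = f u j n" using N[of v] ij v by blast+
      then show "f v i n = f v j n" by (rule trans_sym)
    next
      have "x v (N + n) = x u (N + n)" using W(3) v by blast
      then show "int m mod int q ^ (N + n) = x v (N + n)"
        by (simp only: m_def approx_eq[OF x_closed[OF u] order_refl])
    qed
    also have "(\<Sum>i=1..m. f v (nat_Z i) n) = (\<Sum>i=1..m. f u (nat_Z i) n)"
      by (rule sum.cong[OF refl], rule N) (use v in simp_all)
    finally show ?thesis .
  qed
  then have "\<forall>v\<in>V \<inter> W. S (f v) (x v) n = S (f u) (x u) n"
    using V(2) W(2) by (metis IntI)
  then show "\<exists>V. openin X V \<and> u \<in> V \<and> (\<forall>v\<in>V. S (f v) (x v) n = S (f u) (x u) n)"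
    using V W(1,2) by (intro exI[of _ "V \<inter> W"]) blast
qed

lemma continuous_map_Zq_sum_upper:
  assumes "continuous_map T T f" "continuous_map X T x"
  shows "continuous_map X T (\<lambda>u. S f (x u))"
proof -
  have "continuous_map (prod_topology X T) T (f \<circ> snd)"
    using assms(1) by (intro continuous_map_compose[where X' = T] continuous_map_snd)
  then have "continuous_map (prod_topology X T) T (\<lambda>(u, i). f i)"
    by (simp add: comp_def case_prod_unfold)
  then show ?thesis by (rule continuous_map_Zq_sum) (rule assms(2))
qed

lemma Zq_sum_zero:
  assumes f: "continuous_map T T f"
  shows "S f \<zero>\<^bsub>Z\<^esub> = \<zero>\<^bsub>Z\<^esub>"
proof
  fix n
  obtain N where N: "\<And>i j. \<lbrakk>i \<in> carrier Z; j \<in> carrier Z; i N = j N\<rbrakk> \<Longrightarrow> f i n = f j n"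
    by (rule uniform_modulus_single[OF f, where n = n], rule that)
  have "S f \<zero>\<^bsub>Z\<^esub> n = (\<Sum>i=1..0. f (nat_Z i) n) mod int q ^ n"
    by (rule Zq_sum_level[OF f R.zero_closed, where N = N], rule N) (simp_all add: zero_level)
  then show "S f \<zero>\<^bsub>Z\<^esub> n = \<zero>\<^bsub>Z\<^esub> n" by (simp add: zero_level)
qed

lemma Zq_sum_step:
  assumes f: "continuous_map T T f" and x: "x \<in> carrier Z"
  shows "S f (x \<oplus>\<^bsub>Z\<^esub> \<one>\<^bsub>Z\<^esub>) = S f x \<oplus>\<^bsub>Z\<^esub> f (x \<oplus>\<^bsub>Z\<^esub> \<one>\<^bsub>Z\<^esub>)"
proof
  fix n
  obtain N where N: "\<And>i j. \<lbrakk>i \<in> carrier Z; j \<in> carrier Z; i N = j N\<rbrakk> \<Longrightarrow> f i n = f j n"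
    by (rule uniform_modulus_single[OF f, where n = n], rule that)
  define m where "m = nat (x (N + n))"
  have m: "int m mod int q ^ (N + n) = x (N + n)"
    unfolding m_def by (rule nat_approx[OF x])
  have x1: "x \<oplus>\<^bsub>Z\<^esub> \<one>\<^bsub>Z\<^esub> \<in> carrier Z" using x by simp
  have m1: "int (Suc m) mod int q ^ (N + n) = (x \<oplus>\<^bsub>Z\<^esub> \<one>\<^bsub>Z\<^esub>) (N + n)"
    by (simp add: add_level one_level mod_simps add.commute flip: m)
  have "nat_Z (Suc m) (N + n) = (x \<oplus>\<^bsub>Z\<^esub> \<one>\<^bsub>Z\<^esub>) (N + n)"
    by (simp only: nat_Z_level m1)
  then have "nat_Z (Suc m) N = (x \<oplus>\<^bsub>Z\<^esub> \<one>\<^bsub>Z\<^esub>) N"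
    by (rule level_eq_mono[OF nat_Z_closed x1]) simp
  then have fm: "f (nat_Z (Suc m)) n = f (x \<oplus>\<^bsub>Z\<^esub> \<one>\<^bsub>Z\<^esub>) n"
    by (intro N nat_Z_closed x1)
  have "S f x n = (\<Sum>i=1..m. f (nat_Z i) n) mod int q ^ n"
    by (rule Zq_sum_level[OF f x, where N = N], rule N) (simp_all only: m)
  moreover have "S f (x \<oplus>\<^bsub>Z\<^esub> \<one>\<^bsub>Z\<^esub>) n = (\<Sum>i=1..Suc m. f (nat_Z i) n) mod int q ^ n"
    by (rule Zq_sum_level[OF f x1, where N = N], rule N) (simp_all only: m1)
  ultimately show "S f (x \<oplus>\<^bsub>Z\<^esub> \<one>\<^bsub>Z\<^esub>) n = (S f x \<oplus>\<^bsub>Z\<^esub> f (x \<oplus>\<^bsub>Z\<^esub> \<one>\<^bsub>Z\<^esub>)) n"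
    by (simp add: add_level fm mod_simps)
qed

text \<open>The recursion determines a function on the dense set of natural numbers. The laws for
  constant, added, split, nested and exchanged sums below are instances: one side is shown to be
  continuous and to satisfy the recursion of the other.\<close>

lemma Zq_sum_unique:
  assumes f: "continuous_map T T f" and H: "continuous_map T T H"
    and "H \<zero>\<^bsub>Z\<^esub> = \<zero>\<^bsub>Z\<^esub>"
    and "\<And>c. c \<in> carrier Z \<Longrightarrow> H (c \<oplus>\<^bsub>Z\<^esub> \<one>\<^bsub>Z\<^esub>) = H c \<oplus>\<^bsub>Z\<^esub> f (c \<oplus>\<^bsub>Z\<^esub> \<one>\<^bsub>Z\<^esub>)"
    and x: "x \<in> carrier Z"
  shows "H x = S f x"
proof (rule continuous_eq_on_nat[OF H _ _ x])
  show "continuous_map T T (S f)"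
    using continuous_map_Zq_sum_upper[OF f continuous_map_id] by simp
  show "H (nat_Z m) = S f (nat_Z m)" for m
    by (induction m) (simp_all add: nat_Z_0 nat_Z_Suc assms Zq_sum_zero Zq_sum_step)
qed

lemma Zq_sum_at_one:
  assumes f: "continuous_map T T f"
  shows "S f \<one>\<^bsub>Z\<^esub> = f \<one>\<^bsub>Z\<^esub>"
  using Zq_sum_step[OF f R.zero_closed] continuous_closed[OF f R.one_closed]
  by (simp add: Zq_sum_zero[OF f])

lemma Zq_sum_const_one:
  assumes "x \<in> carrier Z"
  shows "S (\<lambda>_. \<one>\<^bsub>Z\<^esub>) x = x"
  by (rule Zq_sum_unique[where H = "\<lambda>x. x", symmetric]) (use assms in simp_all)

lemma Zq_sum_add:
  assumes f: "continuous_map T T f" and g: "continuous_map T T g" and x: "x \<in> carrier Z"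
  shows "S (\<lambda>i. f i \<oplus>\<^bsub>Z\<^esub> g i) x = S f x \<oplus>\<^bsub>Z\<^esub> S g x"
proof (rule Zq_sum_unique[where H = "\<lambda>x. S f x \<oplus>\<^bsub>Z\<^esub> S g x", symmetric, OF _ _ _ _ x])
  have id: "continuous_map T T (\<lambda>x. x)" by simp
  show "continuous_map T T (\<lambda>x. S f x \<oplus>\<^bsub>Z\<^esub> S g x)"
    by (intro continuous_map_T_add continuous_map_Zq_sum_upper f g id)
  fix c assume c: "c \<in> carrier Z"
  then show "S f (c \<oplus>\<^bsub>Z\<^esub> \<one>\<^bsub>Z\<^esub>) \<oplus>\<^bsub>Z\<^esub> S g (c \<oplus>\<^bsub>Z\<^esub> \<one>\<^bsub>Z\<^esub>) =
      S f c \<oplus>\<^bsub>Z\<^esub> S g c \<oplus>\<^bsub>Z\<^esub> (f (c \<oplus>\<^bsub>Z\<^esub> \<one>\<^bsub>Z\<^esub>) \<oplus>\<^bsub>Z\<^esub> g (c \<oplus>\<^bsub>Z\<^esub> \<one>\<^bsub>Z\<^esub>))"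
    using continuous_closed[OF f] continuous_closed[OF g] Zq_sum_closed[OF f] Zq_sum_closed[OF g]
    by (simp add: Zq_sum_step f g R.a_ac)
qed (simp_all add: Zq_sum_zero continuous_map_T_add f g)

text \<open>With \<open>a\<close> fixed, the difference \<open>S f (a + b) - S f a\<close> is continuous in \<open>b\<close> and grows by
  \<open>f (a + b + 1)\<close> when \<open>b\<close> grows by one, which characterizes the shifted sum.\<close>

lemma Zq_sum_split:
  assumes f: "continuous_map T T f" and a: "a \<in> carrier Z" and b: "b \<in> carrier Z"
  shows "S f (a \<oplus>\<^bsub>Z\<^esub> b) = S f a \<oplus>\<^bsub>Z\<^esub> S (\<lambda>j. f (j \<oplus>\<^bsub>Z\<^esub> a)) b"
proof -
  have id: "continuous_map T T (\<lambda>x. x)" by simp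
  have const: "continuous_map T T (\<lambda>x. c)" if "c \<in> carrier Z" for c
    using that by simp
  have "continuous_map T T (f \<circ> (\<lambda>j. j \<oplus>\<^bsub>Z\<^esub> a))"
    by (intro continuous_map_compose[OF _ f] continuous_map_T_add id const a)
  then have g: "continuous_map T T (\<lambda>j. f (j \<oplus>\<^bsub>Z\<^esub> a))" by (simp add: comp_def)
  have Sf: "S f c \<in> carrier Z" if "c \<in> carrier Z" for c
    using f that by (rule Zq_sum_closed)
  let ?H = "\<lambda>b. S f (a \<oplus>\<^bsub>Z\<^esub> b) \<ominus>\<^bsub>Z\<^esub> S f a"
  have H: "?H b = S (\<lambda>j. f (j \<oplus>\<^bsub>Z\<^esub> a)) b"
  proof (rule Zq_sum_unique[where H = ?H, OF g _ _ _ b])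
    show "continuous_map T T ?H"
      unfolding a_minus_def
      by (intro continuous_map_T_add continuous_map_Zq_sum_upper f id const a R.a_inv_closed Sf)
    show "?H \<zero>\<^bsub>Z\<^esub> = \<zero>\<^bsub>Z\<^esub>" using a Sf by (simp add: a_minus_def R.r_neg)
    fix c assume c: "c \<in> carrier Z"
    have "a \<oplus>\<^bsub>Z\<^esub> (c \<oplus>\<^bsub>Z\<^esub> \<one>\<^bsub>Z\<^esub>) = a \<oplus>\<^bsub>Z\<^esub> c \<oplus>\<^bsub>Z\<^esub> \<one>\<^bsub>Z\<^esub>"
        "c \<oplus>\<^bsub>Z\<^esub> \<one>\<^bsub>Z\<^esub> \<oplus>\<^bsub>Z\<^esub> a = a \<oplus>\<^bsub>Z\<^esub> c \<oplus>\<^bsub>Z\<^esub> \<one>\<^bsub>Z\<^esub>"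
      using a c by (simp_all add: R.a_ac)
    moreover have "a \<oplus>\<^bsub>Z\<^esub> c \<in> carrier Z" using a c by simp
    ultimately have "S f (a \<oplus>\<^bsub>Z\<^esub> (c \<oplus>\<^bsub>Z\<^esub> \<one>\<^bsub>Z\<^esub>)) =
        S f (a \<oplus>\<^bsub>Z\<^esub> c) \<oplus>\<^bsub>Z\<^esub> f (c \<oplus>\<^bsub>Z\<^esub> \<one>\<^bsub>Z\<^esub> \<oplus>\<^bsub>Z\<^esub> a)"
      by (simp only: Zq_sum_step[OF f])
    then show "?H (c \<oplus>\<^bsub>Z\<^esub> \<one>\<^bsub>Z\<^esub>) = ?H c \<oplus>\<^bsub>Z\<^esub> f (c \<oplus>\<^bsub>Z\<^esub> \<one>\<^bsub>Z\<^esub> \<oplus>\<^bsub>Z\<^esub> a)"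
      using a c Sf continuous_closed[OF f] by (simp add: a_minus_def R.a_ac)
  qed
  show ?thesis
    using a b Sf by (simp add: a_minus_def R.a_ac R.r_neg2 flip: H)
qed

lemma continuous_shift_family:
  assumes f: "continuous_map X T f" and g: "continuous_map T T g"
  shows "continuous_map (prod_topology X T) T (\<lambda>(u, j). g (j \<oplus>\<^bsub>Z\<^esub> f u))"
proof -
  have "continuous_map (prod_topology X T) T (f \<circ> fst)"
    by (rule continuous_map_compose[OF continuous_map_fst f])
  then have "continuous_map (prod_topology X T) T (\<lambda>w. f (fst w))" by (simp add: comp_def)
  moreover have "continuous_map (prod_topology X T) T snd" by (rule continuous_map_snd)
  ultimately have "continuous_map (prod_topology X T) T (g \<circ> (\<lambda>w. snd w \<oplus>\<^bsub>Z\<^esub> f (fst w)))"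
    by (intro continuous_map_compose[OF _ g] continuous_map_T_add)
  then show ?thesis by (simp add: comp_def case_prod_unfold)
qed

text \<open>Both sides satisfy the same recursion in \<open>x\<close>: by \<open>Zq_sum_split\<close>, the sum of \<open>g\<close> up to \<open>S f (x + 1)\<close>
  extends the sum up to \<open>S f x\<close> by a block of \<open>f (x + 1)\<close> terms.\<close>

lemma Zq_sum_assoc:
  assumes f: "continuous_map T T f" and g: "continuous_map T T g" and x: "x \<in> carrier Z"
  shows "S g (S f x) = S (\<lambda>i. S (\<lambda>j. g (j \<oplus>\<^bsub>Z\<^esub> S f (i \<ominus>\<^bsub>Z\<^esub> \<one>\<^bsub>Z\<^esub>))) (f i)) x"
proof (rule Zq_sum_unique[where H = "\<lambda>x. S g (S f x)", OF _ _ _ _ x])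
  have id: "continuous_map T T (\<lambda>x. x)" by simp
  show "continuous_map T T (\<lambda>i. S (\<lambda>j. g (j \<oplus>\<^bsub>Z\<^esub> S f (i \<ominus>\<^bsub>Z\<^esub> \<one>\<^bsub>Z\<^esub>))) (f i))"
    by (intro continuous_map_Zq_sum continuous_shift_family continuous_map_Zq_sum_upper
        continuous_map_T_minus_one f g id)
  show "continuous_map T T (\<lambda>x. S g (S f x))"
    by (intro continuous_map_Zq_sum_upper f g id)
  show "S g (S f \<zero>\<^bsub>Z\<^esub>) = \<zero>\<^bsub>Z\<^esub>" by (simp add: Zq_sum_zero f g)
  fix c assume c: "c \<in> carrier Z"
  have "c \<oplus>\<^bsub>Z\<^esub> \<one>\<^bsub>Z\<^esub> \<ominus>\<^bsub>Z\<^esub> \<one>\<^bsub>Z\<^esub> = c" using c by (simp add: a_minus_def R.a_assoc R.r_neg)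
  then show "S g (S f (c \<oplus>\<^bsub>Z\<^esub> \<one>\<^bsub>Z\<^esub>)) = S g (S f c) \<oplus>\<^bsub>Z\<^esub>
      S (\<lambda>j. g (j \<oplus>\<^bsub>Z\<^esub> S f (c \<oplus>\<^bsub>Z\<^esub> \<one>\<^bsub>Z\<^esub> \<ominus>\<^bsub>Z\<^esub> \<one>\<^bsub>Z\<^esub>))) (f (c \<oplus>\<^bsub>Z\<^esub> \<one>\<^bsub>Z\<^esub>))"
    using c Zq_sum_closed[OF f c] continuous_closed[OF f, of "c \<oplus>\<^bsub>Z\<^esub> \<one>\<^bsub>Z\<^esub>"]
    by (simp add: Zq_sum_step[OF f c] Zq_sum_split[OF g])
qed

text \<open>Fubini: for fixed \<open>x\<close>, the right-hand side obeys the recursion in \<open>y\<close> by additivity, and it is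
  continuous in \<open>y\<close> because sums depend continuously on parameters.\<close>

lemma Zq_sum_swap:
  assumes f: "continuous_map (prod_topology T T) T (\<lambda>(j, i). f j i)"
    and x: "x \<in> carrier Z" and y: "y \<in> carrier Z"
  shows "S (\<lambda>j. S (f j) x) y = S (\<lambda>i. S (\<lambda>j. f j i) y) x"
proof (rule Zq_sum_unique[where H = "\<lambda>y. S (\<lambda>i. S (\<lambda>j. f j i) y) x", OF _ _ _ _ y, symmetric])
  have id: "continuous_map T T (\<lambda>x. x)" by simp
  have const: "continuous_map T T (\<lambda>_. x)" using x by simp
  have "continuous_map (prod_topology T T) T ((\<lambda>(j, i). f j i) \<circ> (\<lambda>w. (snd w, fst w)))"
    by (intro continuous_map_compose[OF _ f] continuous_map_pairedI continuous_map_fst continuous_map_snd)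
  then have f': "continuous_map (prod_topology T T) T (\<lambda>(i, j). f j i)"
    by (simp add: comp_def case_prod_unfold)
  have fi: "continuous_map T T (\<lambda>j. f j i)" and fj: "continuous_map T T (f i)" if "i \<in> carrier Z" for i
    using continuous_section[OF f', of i] continuous_section[OF f, of i] that by simp_all
  show "continuous_map T T (\<lambda>j. S (f j) x)"
    by (rule continuous_map_Zq_sum[OF f const])
  have inner: "continuous_map T T (\<lambda>i. S (\<lambda>j. f j i) c)" if "c \<in> carrier Z" for c
    by (rule continuous_map_Zq_sum[OF f']) (use that in simp)
  have "continuous_map (prod_topology (prod_topology T T) T) T
      ((\<lambda>(j, i). f j i) \<circ> (\<lambda>w. (snd w, snd (fst w))))"
    by (intro continuous_map_compose[OF _ f] continuous_map_pairedI continuous_map_snd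
        continuous_map_compose[OF continuous_map_fst continuous_map_snd, unfolded comp_def])
  then have "continuous_map (prod_topology (prod_topology T T) T) T (\<lambda>(u, j). f j (snd u))"
    by (simp add: comp_def case_prod_unfold)
  then have "continuous_map (prod_topology T T) T (\<lambda>u. S (\<lambda>j. f j (snd u)) (fst u))"
    by (rule continuous_map_Zq_sum) (rule continuous_map_fst)
  then have "continuous_map (prod_topology T T) T (\<lambda>(y, i). S (\<lambda>j. f j i) y)"
    by (simp add: case_prod_unfold)
  then show "continuous_map T T (\<lambda>y. S (\<lambda>i. S (\<lambda>j. f j i) y) x)"
    by (rule continuous_map_Zq_sum) (rule const)
  have "S (\<lambda>i. S (\<lambda>j. f j i) \<zero>\<^bsub>Z\<^esub>) x = S (\<lambda>i. \<zero>\<^bsub>Z\<^esub>) x"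
    by (rule Zq_sum_cong) (simp_all add: Zq_sum_zero fi)
  also have "S (\<lambda>i. \<zero>\<^bsub>Z\<^esub>) x = \<zero>\<^bsub>Z\<^esub>"
    by (rule Zq_sum_unique[where H = "\<lambda>x. \<zero>\<^bsub>Z\<^esub>", symmetric]) (simp_all add: x)
  finally show "S (\<lambda>i. S (\<lambda>j. f j i) \<zero>\<^bsub>Z\<^esub>) x = \<zero>\<^bsub>Z\<^esub>" .
  fix c assume c: "c \<in> carrier Z"
  have c1: "c \<oplus>\<^bsub>Z\<^esub> \<one>\<^bsub>Z\<^esub> \<in> carrier Z" using c by simp
  have "S (\<lambda>i. S (\<lambda>j. f j i) (c \<oplus>\<^bsub>Z\<^esub> \<one>\<^bsub>Z\<^esub>)) x =
      S (\<lambda>i. S (\<lambda>j. f j i) c \<oplus>\<^bsub>Z\<^esub> f (c \<oplus>\<^bsub>Z\<^esub> \<one>\<^bsub>Z\<^esub>) i) x"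
  proof (rule Zq_sum_cong)
    show "S (\<lambda>j. f j i) (c \<oplus>\<^bsub>Z\<^esub> \<one>\<^bsub>Z\<^esub>) = S (\<lambda>j. f j i) c \<oplus>\<^bsub>Z\<^esub> f (c \<oplus>\<^bsub>Z\<^esub> \<one>\<^bsub>Z\<^esub>) i"
      if "i \<in> carrier Z" for i
      by (rule Zq_sum_step[OF fi[OF that] c])
    show "(\<lambda>i. S (\<lambda>j. f j i) c \<oplus>\<^bsub>Z\<^esub> f (c \<oplus>\<^bsub>Z\<^esub> \<one>\<^bsub>Z\<^esub>) i) \<in> carrier Z \<rightarrow> carrier Z"
      using Zq_sum_closed[OF fi c] continuous_closed[OF fj[OF c1]] by blast
  qed
  also have "\<dots> = S (\<lambda>i. S (\<lambda>j. f j i) c) x \<oplus>\<^bsub>Z\<^esub> S (f (c \<oplus>\<^bsub>Z\<^esub> \<one>\<^bsub>Z\<^esub>)) x"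
    by (rule Zq_sum_add[OF inner[OF c] fj[OF c1] x])
  finally show "S (\<lambda>i. S (\<lambda>j. f j i) (c \<oplus>\<^bsub>Z\<^esub> \<one>\<^bsub>Z\<^esub>)) x =
      S (\<lambda>i. S (\<lambda>j. f j i) c) x \<oplus>\<^bsub>Z\<^esub> S (f (c \<oplus>\<^bsub>Z\<^esub> \<one>\<^bsub>Z\<^esub>)) x" .
qed

end

section \<open>The category of metrizable spaces\<close>

lemma topspace_times [simp]:
  "topspace (X \<otimes>\<^sub>T Y) = {Pair u v |u v. u \<in> topspace X \<and> v \<in> topspace Y}"
  by (auto simp: times_space_def topspace_pullback_topology)

lemma continuous_pfst: "continuous_map (X \<otimes>\<^sub>T Y) X pfst"
  and continuous_psnd: "continuous_map (X \<otimes>\<^sub>T Y) Y psnd"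
  unfolding times_space_def
  using continuous_map_pullback[OF continuous_map_fst[of X Y], of "{Pair u v |u v. True}" "\<lambda>w. (pfst w, psnd w)"]
    continuous_map_pullback[OF continuous_map_snd[of X Y], of "{Pair u v |u v. True}" "\<lambda>w. (pfst w, psnd w)"]
  by (simp_all add: comp_def)

lemma continuous_Pair:
  assumes "continuous_map W X f" "continuous_map W Y g"
  shows "continuous_map W (X \<otimes>\<^sub>T Y) (\<lambda>w. Pair (f w) (g w))"
  unfolding times_space_def
  by (rule continuous_map_pullback') (use assms in \<open>auto simp: comp_def intro: continuous_map_pairedI\<close>)

lemma metrizable_times:
  assumes "metrizable_space X" "metrizable_space Y"
  shows "metrizable_space (X \<otimes>\<^sub>T Y)"
proof -
  have "homeomorphic_maps (X \<otimes>\<^sub>T Y) (prod_topology X Y) (\<lambda>w. (pfst w, psnd w)) (\<lambda>p. Pair (fst p) (snd p))"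
    unfolding homeomorphic_maps_def
    by (auto intro!: continuous_map_pairedI continuous_pfst continuous_psnd continuous_Pair
        continuous_map_fst continuous_map_snd)
  then have "(X \<otimes>\<^sub>T Y) homeomorphic_space prod_topology X Y"
    unfolding homeomorphic_space_def by blast
  then show ?thesis
    using assms by (simp add: homeomorphic_metrizable_space metrizable_space_prod_topology)
qed

lemma metrizable_star: "metrizable_space star_space"
  by (simp add: star_space_def)

lemma topspace_star [simp]: "topspace star_space = {Star}"
  by (simp add: star_space_def)

lemma mk_tmap_simps [simp]:
  "tdom (mk_tmap X Y f) = X" "tcod (mk_tmap X Y f) = Y"
  "tfun (mk_tmap X Y f) = restrict f (topspace X)"
  by (simp_all add: mk_tmap_def)

lemma Top_mtr_simps [simp]:
  "Obj Top_mtr = {X. metrizable_space X}" "Dom Top_mtr = tdom" "Cod Top_mtr = tcod"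
  "Idn Top_mtr X = mk_tmap X X (\<lambda>u. u)"
  "g \<cdot>\<^bsub>Top_mtr\<^esub> f = mk_tmap (tdom f) (tcod g) (tfun g \<circ> tfun f)"
  by (simp_all add: Top_mtr_def)

lemma Hom_iff:
  "f \<in> Hom Top_mtr X Y \<longleftrightarrow> tdom f = X \<and> tcod f = Y \<and> metrizable_space X \<and> metrizable_space Y \<and>
     continuous_map X Y (tfun f) \<and> tfun f \<in> extensional (topspace X)"
  by (cases f) (auto simp: Hom_def Top_mtr_def)

lemma Arr_Hom: "f \<in> Arr Top_mtr \<longleftrightarrow> f \<in> Hom Top_mtr (tdom f) (tcod f)"
  by (simp add: Hom_def)

lemma mk_tmap_Hom:
  assumes "metrizable_space X" "metrizable_space Y" "continuous_map X Y f"
  shows "mk_tmap X Y f \<in> Hom Top_mtr X Y"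
proof -
  have "continuous_map X Y (restrict f (topspace X))"
    by (rule continuous_map_eq[OF assms(3)]) simp
  then show ?thesis using assms(1,2) by (simp add: Hom_iff)
qed

lemma Hom_in: "f \<in> Hom Top_mtr X Y \<Longrightarrow> u \<in> topspace X \<Longrightarrow> tfun f u \<in> topspace Y"
  using continuous_map_image_subset_topspace[of X Y "tfun f"] by (auto simp: Hom_iff)

lemma tmap_eqI:
  assumes f: "f \<in> Hom Top_mtr X Y" and g: "g \<in> Hom Top_mtr X Y"
    and eq: "\<And>u. u \<in> topspace X \<Longrightarrow> tfun f u = tfun g u"
  shows "f = g"
proof -
  have "tfun f = tfun g"
    by (rule extensionalityI[where A = "topspace X"]) (use f g eq in \<open>simp_all add: Hom_iff\<close>)
  then show ?thesis using f g by (auto simp: Hom_iff intro: tmap.expand)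
qed

lemma Cmp_Hom_Top:
  assumes "f \<in> Hom Top_mtr X Y" "g \<in> Hom Top_mtr Y W"
  shows "g \<cdot>\<^bsub>Top_mtr\<^esub> f \<in> Hom Top_mtr X W"
proof -
  have "continuous_map X W (tfun g \<circ> tfun f)"
    using assms by (intro continuous_map_compose[where X' = Y]) (simp_all add: Hom_iff)
  moreover have "tdom f = X" "tcod g = W" "metrizable_space X" "metrizable_space W"
    using assms by (simp_all add: Hom_iff)
  ultimately show ?thesis by (simp add: mk_tmap_Hom)
qed

lemma Idn_Hom_Top: "metrizable_space X \<Longrightarrow> Idn Top_mtr X \<in> Hom Top_mtr X X"
  by (simp add: mk_tmap_Hom)

lemma tfun_Cmp:
  "f \<in> Hom Top_mtr X Y \<Longrightarrow> u \<in> topspace X \<Longrightarrow> tfun (g \<cdot>\<^bsub>Top_mtr\<^esub> f) u = tfun g (tfun f u)"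
  by (simp add: Hom_iff)

lemma category_Top_mtr: "category Top_mtr"
proof
  fix W X Y V :: "'a topology" and f g h
  show "f \<in> Arr Top_mtr \<Longrightarrow> Dom Top_mtr f \<in> Obj Top_mtr"
    "f \<in> Arr Top_mtr \<Longrightarrow> Cod Top_mtr f \<in> Obj Top_mtr" for f :: "'a tmap"
    by (simp_all add: Arr_Hom Hom_iff)
  show "X \<in> Obj Top_mtr \<Longrightarrow> Idn Top_mtr X \<in> Hom Top_mtr X X"
    by (simp add: mk_tmap_Hom)
  show "f \<in> Hom Top_mtr X Y \<Longrightarrow> g \<in> Hom Top_mtr Y W \<Longrightarrow> g \<cdot>\<^bsub>Top_mtr\<^esub> f \<in> Hom Top_mtr X W"
    by (rule Cmp_Hom_Top)
  show "f \<cdot>\<^bsub>Top_mtr\<^esub> Idn Top_mtr X = f" if f: "f \<in> Hom Top_mtr X Y"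
  proof (rule tmap_eqI)
    have X: "metrizable_space X" using f by (simp add: Hom_iff)
    show "f \<cdot>\<^bsub>Top_mtr\<^esub> Idn Top_mtr X \<in> Hom Top_mtr X Y"
      by (rule Cmp_Hom_Top[OF Idn_Hom_Top[OF X] f])
  qed (use f in simp_all)
  show "Idn Top_mtr Y \<cdot>\<^bsub>Top_mtr\<^esub> f = f" if f: "f \<in> Hom Top_mtr X Y"
  proof (rule tmap_eqI)
    have Y: "metrizable_space Y" using f by (simp add: Hom_iff)
    show "Idn Top_mtr Y \<cdot>\<^bsub>Top_mtr\<^esub> f \<in> Hom Top_mtr X Y"
      by (rule Cmp_Hom_Top[OF f Idn_Hom_Top[OF Y]])
  qed (use f Hom_in[OF f] in \<open>auto simp: Hom_iff\<close>)
  show "h \<cdot>\<^bsub>Top_mtr\<^esub> (g \<cdot>\<^bsub>Top_mtr\<^esub> f) = (h \<cdot>\<^bsub>Top_mtr\<^esub> g) \<cdot>\<^bsub>Top_mtr\<^esub> f"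
    if f: "f \<in> Hom Top_mtr W X" and g: "g \<in> Hom Top_mtr X Y" and h: "h \<in> Hom Top_mtr Y V"
  proof (rule tmap_eqI)
    have gf: "g \<cdot>\<^bsub>Top_mtr\<^esub> f \<in> Hom Top_mtr W Y" and hg: "h \<cdot>\<^bsub>Top_mtr\<^esub> g \<in> Hom Top_mtr X V"
      by (rule Cmp_Hom_Top[OF f g], rule Cmp_Hom_Top[OF g h])
    show "h \<cdot>\<^bsub>Top_mtr\<^esub> (g \<cdot>\<^bsub>Top_mtr\<^esub> f) \<in> Hom Top_mtr W V"
      by (rule Cmp_Hom_Top[OF gf h])
    show "(h \<cdot>\<^bsub>Top_mtr\<^esub> g) \<cdot>\<^bsub>Top_mtr\<^esub> f \<in> Hom Top_mtr W V"
      by (rule Cmp_Hom_Top[OF f hg])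
    fix u assume u: "u \<in> topspace W"
    show "tfun (h \<cdot>\<^bsub>Top_mtr\<^esub> (g \<cdot>\<^bsub>Top_mtr\<^esub> f)) u = tfun ((h \<cdot>\<^bsub>Top_mtr\<^esub> g) \<cdot>\<^bsub>Top_mtr\<^esub> f) u"
      by (simp only: tfun_Cmp[OF gf u] tfun_Cmp[OF f u] tfun_Cmp[OF g Hom_in[OF f u]])
  qed
qed

lemma star_terminal: "is_terminal Top_mtr star_space"
  unfolding is_terminal_def
proof (intro conjI ballI)
  fix X :: "'a point topology" assume "X \<in> Obj Top_mtr"
  then have X: "metrizable_space X" by simp
  show "\<exists>!f. f \<in> Hom Top_mtr X star_space"
  proof (rule ex1I)
    show f: "mk_tmap X star_space (\<lambda>_. Star) \<in> Hom Top_mtr X star_space"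
      by (intro mk_tmap_Hom X metrizable_star) simp
    fix g assume g: "g \<in> Hom Top_mtr X star_space"
    show "g = mk_tmap X star_space (\<lambda>_. Star)"
      by (rule tmap_eqI[OF g f]) (use Hom_in[OF g] in simp)
  qed
qed (simp add: metrizable_star)

text \<open>A product of metrizable spaces expressed by functions on points. Uniqueness of the mediating map
  is replaced by joint injectivity of the projections, which also applies to maps into subspaces
  of \<open>P\<close>.\<close>

definition is_top_product ::
  "'i set \<Rightarrow> ('i \<Rightarrow> 'a point topology) \<Rightarrow> 'a point topology \<Rightarrow> ('i \<Rightarrow> 'a point \<Rightarrow> 'a point) \<Rightarrow> bool" where
  "is_top_product I Fo P \<pi> \<longleftrightarrow> metrizable_space P \<and>
     (\<forall>i\<in>I. continuous_map P (Fo i) (\<pi> i)) \<and>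
     (\<forall>p\<in>topspace P. \<forall>p'\<in>topspace P. (\<forall>i\<in>I. \<pi> i p = \<pi> i p') \<longrightarrow> p = p') \<and>
     (\<forall>(X :: 'a point topology) k. (\<forall>i\<in>I. continuous_map X (Fo i) (k i)) \<longrightarrow>
       (\<exists>h. continuous_map X P h \<and> (\<forall>i\<in>I. \<forall>x\<in>topspace X. \<pi> i (h x) = k i x)))"

lemma finite_products:
  assumes "finite I" "\<And>i. i \<in> I \<Longrightarrow> metrizable_space (Fo i)"
  shows "\<exists>P \<pi>. is_top_product I (Fo :: 'i \<Rightarrow> 'a point topology) P \<pi>"
  using assms
proof (induction I rule: finite_induct)
  case empty
  have "is_top_product {} Fo star_space undefined"
    unfolding is_top_product_def
    by (intro conjI metrizable_star allI impI exI[of _ "\<lambda>_. Star"]) simp_all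
  then show ?case by blast
next
  case (insert j I)
  have "\<exists>P \<pi>. is_top_product I Fo P \<pi>"
    by (rule insert.IH) (rule insert.prems, rule insertI2)
  then obtain P \<pi> where "is_top_product I Fo P \<pi>" by (elim exE)
  then have P: "metrizable_space P"
    and \<pi>: "\<And>i. i \<in> I \<Longrightarrow> continuous_map P (Fo i) (\<pi> i)"
    and inj: "\<And>p p'. \<lbrakk>p \<in> topspace P; p' \<in> topspace P; \<forall>i\<in>I. \<pi> i p = \<pi> i p'\<rbrakk> \<Longrightarrow> p = p'"
    and univ: "\<And>(X :: 'a point topology) k. \<forall>i\<in>I. continuous_map X (Fo i) (k i) \<Longrightarrow>
      \<exists>h. continuous_map X P h \<and> (\<forall>i\<in>I. \<forall>x\<in>topspace X. \<pi> i (h x) = k i x)"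
    unfolding is_top_product_def by blast+
  let ?\<pi> = "\<lambda>i w. if i = j then pfst w else \<pi> i (psnd w)"
  have ij: "i \<noteq> j" if "i \<in> I" for i using insert.hyps that by blast
  have "is_top_product (insert j I) Fo (Fo j \<otimes>\<^sub>T P) ?\<pi>"
    unfolding is_top_product_def
  proof (intro conjI ballI allI impI)
    show "metrizable_space (Fo j \<otimes>\<^sub>T P)"
      by (intro metrizable_times P insert.prems) simp
    show "continuous_map (Fo j \<otimes>\<^sub>T P) (Fo i) (?\<pi> i)" if "i \<in> insert j I" for i
    proof (cases "i = j")
      case True
      then show ?thesis by (simp add: continuous_pfst)
    next
      case False
      then have "continuous_map (Fo j \<otimes>\<^sub>T P) (Fo i) (\<pi> i \<circ> psnd)"
        using that by (intro continuous_map_compose[OF continuous_psnd] \<pi>) simp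
      then show ?thesis using False by (simp add: comp_def)
    qed
    fix w w' assume w: "w \<in> topspace (Fo j \<otimes>\<^sub>T P)" "w' \<in> topspace (Fo j \<otimes>\<^sub>T P)"
      and eq: "\<forall>i\<in>insert j I. ?\<pi> i w = ?\<pi> i w'"
    have "pfst w = pfst w'" using eq by simp
    moreover have "psnd w = psnd w'"
    proof (rule inj)
      show "\<forall>i\<in>I. \<pi> i (psnd w) = \<pi> i (psnd w')"
      proof
        fix i assume "i \<in> I"
        with bspec[OF eq, of i] ij show "\<pi> i (psnd w) = \<pi> i (psnd w')" by simp
      qed
    qed (use w in auto)
    ultimately show "w = w'" using w by auto
  next
    fix X :: "'a point topology" and k
    assume k: "\<forall>i\<in>insert j I. continuous_map X (Fo i) (k i)"
    then obtain h where h: "continuous_map X P h" "\<forall>i\<in>I. \<forall>x\<in>topspace X. \<pi> i (h x) = k i x"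
      using univ[of X k] by blast
    show "\<exists>h. continuous_map X (Fo j \<otimes>\<^sub>T P) h \<and> (\<forall>i\<in>insert j I. \<forall>x\<in>topspace X. ?\<pi> i (h x) = k i x)"
    proof (intro exI[of _ "\<lambda>x. Pair (k j x) (h x)"] conjI ballI)
      show "continuous_map X (Fo j \<otimes>\<^sub>T P) (\<lambda>x. Pair (k j x) (h x))"
        by (intro continuous_Pair h) (use k in simp)
      show "?\<pi> i (Pair (k j x) (h x)) = k i x" if "i \<in> insert j I" "x \<in> topspace X" for i x
        using h(2) that by auto
    qed
  qed
  then show ?case by blast
qed

text \<open>A limit is the equalizing subspace of a finite product; metrizability passes to both.\<close>

lemma finitely_complete_Top_mtr:
  "finitely_complete_category (Top_mtr :: ('a point topology, 'a point tmap) category)"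
proof (intro finitely_complete_category.intro finitely_complete_category_axioms.intro category_Top_mtr)
  fix J :: "(nat, nat) category" and Fo :: "nat \<Rightarrow> 'a point topology" and Fa
  assume "finite_category J" and D: "diagram J Top_mtr Fo Fa"
  then have fin: "finite (Obj J)" by (simp add: finite_category.finite_Obj)
  interpret diagram J Top_mtr Fo Fa by (rule D)
  have Fo: "metrizable_space (Fo i)" if "i \<in> Obj J" for i
    using Fo_Obj[OF that] by simp
  have Fa: "Fa a \<in> Hom Top_mtr (Fo (Dom J a)) (Fo (Cod J a))" if "a \<in> Arr J" for a
    using that by (intro Fa_Hom) (simp add: Hom_def)
  have "\<exists>P \<pi>. is_top_product (Obj J) Fo P \<pi>"
    by (rule finite_products[OF fin Fo])
  then obtain P \<pi> where "is_top_product (Obj J) Fo P \<pi>" by (elim exE)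
  then have P: "metrizable_space P"
    and \<pi>: "\<And>i. i \<in> Obj J \<Longrightarrow> continuous_map P (Fo i) (\<pi> i)"
    and inj: "\<And>p p'. \<lbrakk>p \<in> topspace P; p' \<in> topspace P; \<forall>i\<in>Obj J. \<pi> i p = \<pi> i p'\<rbrakk> \<Longrightarrow> p = p'"
    and univ: "\<And>(X :: 'a point topology) k. \<forall>i\<in>Obj J. continuous_map X (Fo i) (k i) \<Longrightarrow>
      \<exists>h. continuous_map X P h \<and> (\<forall>i\<in>Obj J. \<forall>x\<in>topspace X. \<pi> i (h x) = k i x)"
    unfolding is_top_product_def by blast+
  define E where "E = {p. \<forall>a\<in>Arr J. tfun (Fa a) (\<pi> (Dom J a) p) = \<pi> (Cod J a) p}"
  define L where "L = subtopology P E"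
  define l where "l i = mk_tmap L (Fo i) (\<pi> i)" for i
  have L: "metrizable_space L" unfolding L_def by (rule metrizable_space_subtopology[OF P])
  have L_iff: "p \<in> topspace L \<longleftrightarrow> p \<in> topspace P \<and> p \<in> E" for p by (simp add: L_def)
  have l: "l i \<in> Hom Top_mtr L (Fo i)" if "i \<in> Obj J" for i
    unfolding l_def L_def
    by (intro mk_tmap_Hom L[unfolded L_def] Fo that continuous_map_from_subtopology \<pi>)
  have l_fun: "tfun (l i) p = \<pi> i p" if "p \<in> topspace L" for i p
    using that by (simp add: l_def)
  have cone: "is_cone J Top_mtr Fo Fa L l"
    unfolding is_cone_def
  proof (intro conjI ballI)
    show "L \<in> Obj Top_mtr" by (simp add: L)
    show "l i \<in> Hom Top_mtr L (Fo i)" if "i \<in> Obj J" for i by (rule l[OF that])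
    fix a assume a: "a \<in> Arr J"
    note la = l[OF J.Dom_Obj[OF a]]
    show "Fa a \<cdot>\<^bsub>Top_mtr\<^esub> l (Dom J a) = l (Cod J a)"
    proof (rule tmap_eqI[OF Cmp_Hom_Top[OF la Fa[OF a]] l[OF J.Cod_Obj[OF a]]])
      fix p assume p: "p \<in> topspace L"
      then have "p \<in> E" by (simp add: L_iff)
      then show "tfun (Fa a \<cdot>\<^bsub>Top_mtr\<^esub> l (Dom J a)) p = tfun (l (Cod J a)) p"
        using a by (simp only: tfun_Cmp[OF la p] l_fun[OF p] E_def mem_Collect_eq)
    qed
  qed
  have "\<exists>!h. h \<in> Hom Top_mtr X L \<and> (\<forall>i\<in>Obj J. l i \<cdot>\<^bsub>Top_mtr\<^esub> h = k i)"
    if "is_cone J Top_mtr Fo Fa X k" for X k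
  proof -
    have X: "metrizable_space X" and k: "\<And>i. i \<in> Obj J \<Longrightarrow> k i \<in> Hom Top_mtr X (Fo i)"
      and comm: "\<And>a. a \<in> Arr J \<Longrightarrow> Fa a \<cdot>\<^bsub>Top_mtr\<^esub> k (Dom J a) = k (Cod J a)"
      using that unfolding is_cone_def by simp_all
    have "\<forall>i\<in>Obj J. continuous_map X (Fo i) (tfun (k i))" using k by (simp add: Hom_iff)
    then obtain h where h: "continuous_map X P h"
        and h_eq: "\<forall>i\<in>Obj J. \<forall>x\<in>topspace X. \<pi> i (h x) = tfun (k i) x"
      using univ[of X "\<lambda>i. tfun (k i)"] by blast
    have "h x \<in> E" if x: "x \<in> topspace X" for x
      unfolding E_def
    proof (intro CollectI ballI)
      fix a assume a: "a \<in> Arr J"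
      have "tfun (Fa a) (tfun (k (Dom J a)) x) = tfun (k (Cod J a)) x"
        using tfun_Cmp[OF k[OF J.Dom_Obj[OF a]] x, of "Fa a"] unfolding comm[OF a] by (rule sym)
      then show "tfun (Fa a) (\<pi> (Dom J a) (h x)) = \<pi> (Cod J a) (h x)"
        using h_eq x J.Dom_Obj[OF a] J.Cod_Obj[OF a] by simp
    qed
    then have hL: "continuous_map X L h"
      unfolding L_def by (intro continuous_map_into_subtopology[OF h]) blast
    show ?thesis
    proof (rule ex1I)
      have H: "mk_tmap X L h \<in> Hom Top_mtr X L" by (rule mk_tmap_Hom[OF X L hL])
      have "l i \<cdot>\<^bsub>Top_mtr\<^esub> mk_tmap X L h = k i" if i: "i \<in> Obj J" for i
      proof (rule tmap_eqI[OF Cmp_Hom_Top[OF H l[OF i]] k[OF i]])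
        fix x assume x: "x \<in> topspace X"
        then have "tfun (mk_tmap X L h) x = h x" by simp
        then show "tfun (l i \<cdot>\<^bsub>Top_mtr\<^esub> mk_tmap X L h) x = tfun (k i) x"
          using tfun_Cmp[OF H x, of "l i"] l_fun[OF Hom_in[OF H x], of i] h_eq i x by simp
      qed
      then show "mk_tmap X L h \<in> Hom Top_mtr X L \<and> (\<forall>i\<in>Obj J. l i \<cdot>\<^bsub>Top_mtr\<^esub> mk_tmap X L h = k i)"
        using H by blast
      fix g assume g: "g \<in> Hom Top_mtr X L \<and> (\<forall>i\<in>Obj J. l i \<cdot>\<^bsub>Top_mtr\<^esub> g = k i)"
      then have gH: "g \<in> Hom Top_mtr X L" by blast
      show "g = mk_tmap X L h"
      proof (rule tmap_eqI[OF gH H])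
        fix x assume x: "x \<in> topspace X"
        note gx = Hom_in[OF gH x] and hx = Hom_in[OF H x]
        have "tfun g x = h x"
        proof (rule inj)
          show "tfun g x \<in> topspace P" "h x \<in> topspace P"
            using gx hx x by (simp_all add: L_iff)
          show "\<forall>i\<in>Obj J. \<pi> i (tfun g x) = \<pi> i (h x)"
          proof
            fix i assume i: "i \<in> Obj J"
            have "l i \<cdot>\<^bsub>Top_mtr\<^esub> g = k i" using g i by blast
            then have "tfun (k i) x = tfun (l i) (tfun g x)"
              using tfun_Cmp[OF gH x, of "l i"] by (simp only:)
            then show "\<pi> i (tfun g x) = \<pi> i (h x)"
              using h_eq i x l_fun[OF gx] by simp
          qed
        qed
        then show "tfun g x = tfun (mk_tmap X L h) x" using x by simp
      qed
    qed
  qed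
  then show "\<exists>L l. is_limit J Top_mtr Fo Fa L l"
    using cone unfolding is_limit_def by blast
qed

section \<open>The adder of q-adic integers\<close>

context qadic
begin

abbreviation ZT :: "'a point topology" where "ZT \<equiv> Zq_space q"
abbreviation D :: "('a point topology, 'a point tmap) adder" where "D \<equiv> Zq_adder q"

lemma topspace_ZT [simp]: "topspace ZT = Padic ` carrier Z"
  by (auto simp: Zq_space_def topspace_pullback_topology)

lemma continuous_padic: "continuous_map ZT T padic"
  unfolding Zq_space_def
  using continuous_map_pullback[OF continuous_map_id[of T], of "range Padic" padic] by (simp add: comp_def)

lemma continuous_Padic:
  assumes "continuous_map W T f"
  shows "continuous_map W ZT (\<lambda>w. Padic (f w))"
  unfolding Zq_space_def
  by (rule continuous_map_pullback') (use assms in \<open>auto simp: comp_def\<close>)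

lemma metrizable_ZT: "metrizable_space (ZT :: 'a point topology)"
proof -
  have "homeomorphic_maps (ZT :: 'a point topology) T padic Padic"
    unfolding homeomorphic_maps_def
    using continuous_padic continuous_Padic[of T "\<lambda>a. a"] by auto
  then have "(ZT :: 'a point topology) homeomorphic_space T"
    unfolding homeomorphic_space_def by blast
  moreover have "metrizable_space T"
    unfolding Zq_topology_def
    by (intro metrizable_space_subtopology) (simp add: metrizable_space_product_topology)
  ultimately show ?thesis by (simp add: homeomorphic_metrizable_space)
qed

lemma adder_simps [simp]:
  "A\<^sub>D D = ZT" "F\<^sub>D D = ZT \<otimes>\<^sub>T ZT" "T\<^sub>D D = star_space"
  "p\<^sub>D D = mk_tmap (ZT \<otimes>\<^sub>T ZT) ZT psnd"
  "oneF D = mk_tmap star_space (ZT \<otimes>\<^sub>T ZT) (\<lambda>_. Pair (Padic \<one>\<^bsub>Z\<^esub>) (Padic \<one>\<^bsub>Z\<^esub>))"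
  "Ext D x = tdom x \<otimes>\<^sub>T ZT"
  "prj D x = mk_tmap (tdom x \<otimes>\<^sub>T ZT) (tdom x) pfst"
  "prF D x = mk_tmap (tdom x \<otimes>\<^sub>T ZT) (ZT \<otimes>\<^sub>T ZT) (\<lambda>w. Pair (psnd w) (tfun x (pfst w)))"
  by (simp_all add: Zq_adder_def Let_def)

text \<open>The operations of the adder act fibrewise over \<open>U\<close>. The maps \<open>fib f u = f(u, -)\<close> and the values
  \<open>val x u = x(u)\<close> strip off the encoding as points, so that each axiom becomes an identity of sums over
  \<open>\<int>\<^sub>q\<close> for a fixed \<open>u\<close>.\<close>

definition fib :: "'a point tmap \<Rightarrow> 'a point \<Rightarrow> (nat \<Rightarrow> int) \<Rightarrow> (nat \<Rightarrow> int)" where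
  "fib f u i = padic (tfun f (Pair u (Padic i)))"

definition val :: "'a point tmap \<Rightarrow> 'a point \<Rightarrow> (nat \<Rightarrow> int)" where
  "val x u = padic (tfun x u)"

lemma Sig_D: "Sig D x f = mk_tmap (tdom x) ZT (\<lambda>u. Padic (S (fib f u) (val x u)))"
  and Flat_D: "Flat D x f = mk_tmap ((tdom x \<otimes>\<^sub>T ZT) \<otimes>\<^sub>T ZT) (tdom x \<otimes>\<^sub>T ZT)
    (\<lambda>w. Pair (pfst (pfst w)) (Padic (padic (psnd w) \<oplus>\<^bsub>Z\<^esub>
       S (fib f (pfst (pfst w))) (padic (psnd (pfst w)) \<ominus>\<^bsub>Z\<^esub> \<one>\<^bsub>Z\<^esub>))))"
  by (simp_all add: Zq_adder_def Let_def fib_def[abs_def] val_def)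

lemma over_iff: "x \<in> over Top_mtr D \<longleftrightarrow> x \<in> Hom Top_mtr (tdom x) ZT"
  by (auto simp: over_def Hom_def)

lemma val_closed: "x \<in> Hom Top_mtr U ZT \<Longrightarrow> u \<in> topspace U \<Longrightarrow> val x u \<in> carrier Z"
  and Padic_val: "x \<in> Hom Top_mtr U ZT \<Longrightarrow> u \<in> topspace U \<Longrightarrow> tfun x u = Padic (val x u)"
  using Hom_in[of x U ZT u] by (auto simp: val_def)

lemma val_continuous:
  assumes "x \<in> Hom Top_mtr U ZT"
  shows "continuous_map U T (val x)"
proof -
  have "continuous_map U T (padic \<circ> tfun x)"
    by (rule continuous_map_compose[OF _ continuous_padic]) (use assms in \<open>simp add: Hom_iff\<close>)
  then show ?thesis by (simp add: comp_def val_def[abs_def])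
qed

lemma Pair_in [simp]:
  "Pair u v \<in> topspace (X \<otimes>\<^sub>T Y) \<longleftrightarrow> u \<in> topspace X \<and> v \<in> topspace Y"
  by simp

lemma times_ZT_cases:
  assumes "w \<in> topspace (U \<otimes>\<^sub>T ZT)"
  obtains u i where "w = Pair u (Padic i)" "u \<in> topspace U" "i \<in> carrier Z"
  using assms by auto

lemma fib_val: "fib f u i = val f (Pair u (Padic i))"
  by (simp add: fib_def val_def)

lemma fib_joint_continuous:
  assumes "f \<in> Hom Top_mtr (U \<otimes>\<^sub>T ZT) ZT"
  shows "continuous_map (prod_topology U T) T (\<lambda>(u, i). fib f u i)"
proof -
  have "continuous_map (prod_topology U T) (U \<otimes>\<^sub>T ZT) (\<lambda>w. Pair (fst w) (Padic (snd w)))"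
    by (intro continuous_Pair continuous_Padic continuous_map_fst continuous_map_snd)
  then have "continuous_map (prod_topology U T) T (val f \<circ> (\<lambda>w. Pair (fst w) (Padic (snd w))))"
    using val_continuous[OF assms] by (rule continuous_map_compose)
  then show ?thesis by (simp add: comp_def case_prod_unfold fib_val)
qed

lemma fib_continuous:
  assumes "f \<in> Hom Top_mtr (U \<otimes>\<^sub>T ZT) ZT" "u \<in> topspace U"
  shows "continuous_map T T (fib f u)"
  by (rule continuous_section[OF fib_joint_continuous[OF assms(1)] assms(2)])

lemma fib_closed:
  "f \<in> Hom Top_mtr (U \<otimes>\<^sub>T ZT) ZT \<Longrightarrow> u \<in> topspace U \<Longrightarrow> i \<in> carrier Z \<Longrightarrow> fib f u i \<in> carrier Z"
  by (rule continuous_closed[OF fib_continuous])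

lemma prj_Hom: "metrizable_space U \<Longrightarrow> tdom x = U \<Longrightarrow> prj D x \<in> Hom Top_mtr (U \<otimes>\<^sub>T ZT) U"
  by (simp add: mk_tmap_Hom metrizable_times metrizable_ZT continuous_pfst)

lemma prF_Hom: "x \<in> Hom Top_mtr U ZT \<Longrightarrow> prF D x \<in> Hom Top_mtr (U \<otimes>\<^sub>T ZT) (ZT \<otimes>\<^sub>T ZT)"
proof -
  assume x: "x \<in> Hom Top_mtr U ZT"
  then have "continuous_map (U \<otimes>\<^sub>T ZT) ZT (tfun x \<circ> pfst)"
    by (intro continuous_map_compose[OF continuous_pfst]) (simp add: Hom_iff)
  then have "continuous_map (U \<otimes>\<^sub>T ZT) (ZT \<otimes>\<^sub>T ZT) (\<lambda>w. Pair (psnd w) (tfun x (pfst w)))"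
    by (intro continuous_Pair continuous_psnd) (simp add: comp_def)
  moreover have "tdom x = U" "metrizable_space U" using x by (simp_all add: Hom_iff)
  ultimately show ?thesis by (simp add: mk_tmap_Hom metrizable_times metrizable_ZT)
qed

lemma Sig_Hom_Top:
  fixes U :: "'a point topology"
  assumes x: "x \<in> Hom Top_mtr U ZT" and f: "f \<in> Hom Top_mtr (U \<otimes>\<^sub>T ZT) ZT"
  shows "Sig D x f \<in> Hom Top_mtr U ZT"
proof -
  have "continuous_map U (ZT :: 'a point topology) (\<lambda>u. Padic (S (fib f u) (val x u)))"
    by (intro continuous_Padic continuous_map_Zq_sum[OF fib_joint_continuous[OF f] val_continuous[OF x]])
  moreover have "tdom x = U" "metrizable_space U" using x by (simp_all add: Hom_iff)
  ultimately show ?thesis by (simp only: Sig_D mk_tmap_Hom metrizable_ZT)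
qed

lemma val_Sig:
  assumes "x \<in> Hom Top_mtr U ZT" "u \<in> topspace U"
  shows "val (Sig D x f) u = S (fib f u) (val x u)"
  using assms by (simp add: val_def Sig_D Hom_iff)

lemma Flat_Hom_Top:
  assumes x: "x \<in> Hom Top_mtr U ZT" and f: "f \<in> Hom Top_mtr (U \<otimes>\<^sub>T ZT) ZT"
  shows "Flat D x f \<in> Hom Top_mtr ((U \<otimes>\<^sub>T ZT) \<otimes>\<^sub>T ZT) (U \<otimes>\<^sub>T ZT)"
proof -
  let ?E = "(U \<otimes>\<^sub>T ZT) \<otimes>\<^sub>T ZT"
  have 1: "continuous_map ?E U (\<lambda>w. pfst (pfst w))"
    using continuous_map_compose[OF continuous_pfst continuous_pfst] by (simp add: comp_def)
  have 2: "continuous_map ?E T (\<lambda>w. padic (psnd (pfst w)))"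
    using continuous_map_compose[OF continuous_map_compose[OF continuous_pfst continuous_psnd] continuous_padic]
    by (simp add: comp_def)
  have 3: "continuous_map ?E T (\<lambda>w. padic (psnd w))"
    using continuous_map_compose[OF continuous_psnd continuous_padic] by (simp add: comp_def)
  have "continuous_map (prod_topology ?E T) (prod_topology U T) (\<lambda>p. (pfst (pfst (fst p)), snd p))"
    using continuous_map_compose[OF continuous_map_fst 1]
    by (intro continuous_map_pairedI continuous_map_snd) (simp add: comp_def)
  from continuous_map_compose[OF this fib_joint_continuous[OF f]]
  have "continuous_map (prod_topology ?E T) T (\<lambda>(w, i). fib f (pfst (pfst w)) i)"
    by (simp add: comp_def case_prod_unfold)
  then have "continuous_map ?E T (\<lambda>w. S (fib f (pfst (pfst w))) (padic (psnd (pfst w)) \<ominus>\<^bsub>Z\<^esub> \<one>\<^bsub>Z\<^esub>))"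
    by (rule continuous_map_Zq_sum) (intro continuous_map_T_minus_one 2)
  then have "continuous_map ?E (U \<otimes>\<^sub>T ZT) (\<lambda>w. Pair (pfst (pfst w)) (Padic (padic (psnd w) \<oplus>\<^bsub>Z\<^esub>
       S (fib f (pfst (pfst w))) (padic (psnd (pfst w)) \<ominus>\<^bsub>Z\<^esub> \<one>\<^bsub>Z\<^esub>))))"
    by (intro continuous_Pair continuous_Padic continuous_map_T_add 1 3)
  moreover have "tdom x = U" "metrizable_space U" using x by (simp_all add: Hom_iff)
  ultimately show ?thesis by (simp only: Flat_D mk_tmap_Hom metrizable_times metrizable_ZT)
qed

lemma tfun_Flat:
  assumes "tdom x = U" "u \<in> topspace U" "i \<in> carrier Z" "j \<in> carrier Z"
  shows "tfun (Flat D x f) (Pair (Pair u (Padic i)) (Padic j)) =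
    Pair u (Padic (j \<oplus>\<^bsub>Z\<^esub> S (fib f u) (i \<ominus>\<^bsub>Z\<^esub> \<one>\<^bsub>Z\<^esub>)))"
  using assms by (simp add: Flat_D)

lemma fib_Sig:
  assumes "f \<in> Hom Top_mtr (U \<otimes>\<^sub>T ZT) ZT" "u \<in> topspace U" "i \<in> carrier Z"
  shows "fib (Sig D f g) u i = S (fib g (Pair u (Padic i))) (fib f u i)"
  unfolding fib_val[of _ u] by (rule val_Sig[OF assms(1)]) (use assms(2,3) in simp)

lemma fib_Cmp_Flat:
  assumes x: "x \<in> Hom Top_mtr U ZT" and f: "f \<in> Hom Top_mtr (U \<otimes>\<^sub>T ZT) ZT"
    and u: "u \<in> topspace U" and i: "i \<in> carrier Z" and j: "j \<in> carrier Z"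
  shows "fib (g \<cdot>\<^bsub>Top_mtr\<^esub> Flat D x f) (Pair u (Padic i)) j = fib g u (j \<oplus>\<^bsub>Z\<^esub> S (fib f u) (i \<ominus>\<^bsub>Z\<^esub> \<one>\<^bsub>Z\<^esub>))"
proof -
  have w: "Pair (Pair u (Padic i)) (Padic j) \<in> topspace ((U \<otimes>\<^sub>T ZT) \<otimes>\<^sub>T ZT)"
    using u i j by simp
  have "tdom x = U" using x by (simp add: Hom_iff)
  then show ?thesis
    unfolding fib_def by (simp only: tfun_Cmp[OF Flat_Hom_Top[OF x f] w] tfun_Flat[OF _ u i j] fib_def[symmetric])
qed

text \<open>A point of \<open>U \<times>\<^sub>A F\<close> is a triple \<open>(u, (t, s))\<close> with \<open>s = x(u)\<close>, so it is determined by \<open>(u, t)\<close>.\<close>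

lemma pullback_D:
  assumes x: "x \<in> Hom Top_mtr U ZT"
  shows "is_pullback Top_mtr x (p\<^sub>D D) (Ext D x) (prj D x) (prF D x)"
  unfolding is_pullback_def
proof (intro conjI ballI impI)
  have U: "tdom x = U" "metrizable_space U" using x by (simp_all add: Hom_iff)
  have p: "p\<^sub>D D \<in> Hom Top_mtr (ZT \<otimes>\<^sub>T ZT) ZT"
    by (simp add: mk_tmap_Hom metrizable_times metrizable_ZT continuous_psnd)
  note prj = prj_Hom[OF U(2,1)] and prF = prF_Hom[OF x]
  show "Ext D x \<in> Obj Top_mtr" by (simp add: U metrizable_times metrizable_ZT)
  show "prj D x \<in> Hom Top_mtr (Ext D x) (Dom Top_mtr x)" using prj U by simp
  show "prF D x \<in> Hom Top_mtr (Ext D x) (Dom Top_mtr (p\<^sub>D D))" using prF U by simp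
  show "x \<cdot>\<^bsub>Top_mtr\<^esub> prj D x = p\<^sub>D D \<cdot>\<^bsub>Top_mtr\<^esub> prF D x"
  proof (rule tmap_eqI[OF Cmp_Hom_Top[OF prj x] Cmp_Hom_Top[OF prF p]])
    fix w assume w: "w \<in> topspace (U \<otimes>\<^sub>T ZT)"
    show "tfun (x \<cdot>\<^bsub>Top_mtr\<^esub> prj D x) w = tfun (p\<^sub>D D \<cdot>\<^bsub>Top_mtr\<^esub> prF D x) w"
      unfolding tfun_Cmp[OF prj w] tfun_Cmp[OF prF w] using w Hom_in[OF x] by (auto simp: U)
  qed
  fix X a b
  assume "a \<in> Hom Top_mtr X (Dom Top_mtr x)" "b \<in> Hom Top_mtr X (Dom Top_mtr (p\<^sub>D D))"
    and comm: "x \<cdot>\<^bsub>Top_mtr\<^esub> a = p\<^sub>D D \<cdot>\<^bsub>Top_mtr\<^esub> b"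
  then have a: "a \<in> Hom Top_mtr X U" and b: "b \<in> Hom Top_mtr X (ZT \<otimes>\<^sub>T ZT)"
    by (simp_all add: U)
  have ab: "psnd (tfun b w) = tfun x (tfun a w)" if w: "w \<in> topspace X" for w
  proof -
    have "tfun x (tfun a w) = tfun (p\<^sub>D D) (tfun b w)"
      using tfun_Cmp[OF a w, of x] tfun_Cmp[OF b w, of "p\<^sub>D D"] unfolding comm by (simp only:)
    then show ?thesis using Hom_in[OF b w] by simp
  qed
  let ?h = "mk_tmap X (U \<otimes>\<^sub>T ZT) (\<lambda>w. Pair (tfun a w) (pfst (tfun b w)))"
  have "continuous_map X ZT (pfst \<circ> tfun b)"
    by (rule continuous_map_compose[OF _ continuous_pfst[of ZT ZT]]) (use b in \<open>simp add: Hom_iff\<close>)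
  then have h: "?h \<in> Hom Top_mtr X (U \<otimes>\<^sub>T ZT)"
    using a by (intro mk_tmap_Hom continuous_Pair) (simp_all add: Hom_iff comp_def metrizable_times metrizable_ZT)
  show "\<exists>!h. h \<in> Hom Top_mtr X (Ext D x) \<and> prj D x \<cdot>\<^bsub>Top_mtr\<^esub> h = a \<and> prF D x \<cdot>\<^bsub>Top_mtr\<^esub> h = b"
  proof (rule ex1I)
    have "prj D x \<cdot>\<^bsub>Top_mtr\<^esub> ?h = a"
    proof (rule tmap_eqI[OF Cmp_Hom_Top[OF h prj] a])
      fix w assume w: "w \<in> topspace X"
      show "tfun (prj D x \<cdot>\<^bsub>Top_mtr\<^esub> ?h) w = tfun a w"
        unfolding tfun_Cmp[OF h w] using w Hom_in[OF h w] by (simp add: U)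
    qed
    moreover have "prF D x \<cdot>\<^bsub>Top_mtr\<^esub> ?h = b"
    proof (rule tmap_eqI[OF Cmp_Hom_Top[OF h prF] b])
      fix w assume w: "w \<in> topspace X"
      show "tfun (prF D x \<cdot>\<^bsub>Top_mtr\<^esub> ?h) w = tfun b w"
        unfolding tfun_Cmp[OF h w] using w Hom_in[OF h w] Hom_in[OF b w] ab[OF w] by (auto simp: U)
    qed
    ultimately show "?h \<in> Hom Top_mtr X (Ext D x) \<and> prj D x \<cdot>\<^bsub>Top_mtr\<^esub> ?h = a \<and> prF D x \<cdot>\<^bsub>Top_mtr\<^esub> ?h = b"
      using h U by simp
    fix k assume k': "k \<in> Hom Top_mtr X (Ext D x) \<and> prj D x \<cdot>\<^bsub>Top_mtr\<^esub> k = a \<and> prF D x \<cdot>\<^bsub>Top_mtr\<^esub> k = b"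
    then have k: "k \<in> Hom Top_mtr X (U \<otimes>\<^sub>T ZT)" using U by simp
    show "k = ?h"
    proof (rule tmap_eqI[OF k h])
      fix w assume w: "w \<in> topspace X"
      have eq: "tfun a w = tfun (prj D x) (tfun k w)" "tfun b w = tfun (prF D x) (tfun k w)"
        using tfun_Cmp[OF k w, of "prj D x"] tfun_Cmp[OF k w, of "prF D x"] k' by metis+
      obtain u i where "tfun k w = Pair u (Padic i)" "u \<in> topspace U" "i \<in> carrier Z"
        by (rule times_ZT_cases[OF Hom_in[OF k w]])
      then show "tfun k w = tfun ?h w"
        using w by (simp add: U eq)
    qed
  qed
qed

lemma const_one_D:
  assumes X: "metrizable_space (X :: 'a point topology)"
  shows "const_one Top_mtr D X = mk_tmap X ZT (\<lambda>_. Padic \<one>\<^bsub>Z\<^esub>)"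
proof -
  have Z: "metrizable_space (ZT :: 'a point topology)" by (rule metrizable_ZT)
  have ex1: "\<exists>!t. t \<in> Hom Top_mtr X star_space"
    by (rule star_terminal[unfolded is_terminal_def, THEN conjunct2, THEN bspec]) (simp add: X)
  define t where "t = (THE t. t \<in> Hom Top_mtr X star_space)"
  have t: "t \<in> Hom Top_mtr X star_space"
    unfolding t_def by (rule theI'[OF ex1])
  have F: "oneF (D :: ('a point topology, 'a point tmap) adder) \<in> Hom Top_mtr star_space (ZT \<otimes>\<^sub>T ZT)"
    by (simp add: mk_tmap_Hom metrizable_star metrizable_times Z)
  have p: "p\<^sub>D (D :: ('a point topology, 'a point tmap) adder) \<in> Hom Top_mtr (ZT \<otimes>\<^sub>T ZT) ZT"
    by (simp add: mk_tmap_Hom metrizable_times Z continuous_psnd)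
  have c: "const_one Top_mtr D X = (p\<^sub>D D \<cdot>\<^bsub>Top_mtr\<^esub> oneF D) \<cdot>\<^bsub>Top_mtr\<^esub> t"
    by (simp only: const_one_def oneA_def t_def adder_simps)
  have one: "mk_tmap X ZT (\<lambda>_. Padic \<one>\<^bsub>Z\<^esub>) \<in> Hom Top_mtr X ZT"
    by (rule mk_tmap_Hom[OF X Z]) simp
  show ?thesis
    unfolding c
  proof (rule tmap_eqI[OF Cmp_Hom_Top[OF t Cmp_Hom_Top[OF F p]] one])
    fix u assume u: "u \<in> topspace X"
    note tu = Hom_in[OF t u]
    show "tfun ((p\<^sub>D D \<cdot>\<^bsub>Top_mtr\<^esub> oneF D) \<cdot>\<^bsub>Top_mtr\<^esub> t) u = tfun (mk_tmap X ZT (\<lambda>_. Padic \<one>\<^bsub>Z\<^esub>)) u"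
      unfolding tfun_Cmp[OF t u] tfun_Cmp[OF F tu] using u tu by simp
  qed
qed

lemma const_one_Hom:
  "metrizable_space (X :: 'a point topology) \<Longrightarrow> const_one Top_mtr D X \<in> Hom Top_mtr X ZT"
  by (simp add: const_one_D mk_tmap_Hom metrizable_ZT)

lemma val_const_one:
  "metrizable_space (X :: 'a point topology) \<Longrightarrow> u \<in> topspace X \<Longrightarrow>
     val (const_one Top_mtr D X) u = \<one>\<^bsub>Z\<^esub>"
  by (simp add: const_one_D val_def)

lemma times_F_D:
  assumes h: "h \<in> Hom Top_mtr U U'" and y: "y \<in> Hom Top_mtr U' ZT" and x: "y \<cdot>\<^bsub>Top_mtr\<^esub> h = x"
  shows "times_F Top_mtr D h x y =
    mk_tmap (U \<otimes>\<^sub>T ZT) (U' \<otimes>\<^sub>T ZT) (\<lambda>w. Pair (tfun h (pfst w)) (psnd w))" (is "_ = ?k")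
    and times_F_Hom: "times_F Top_mtr D h x y \<in> Hom Top_mtr (U \<otimes>\<^sub>T ZT) (U' \<otimes>\<^sub>T ZT)"
proof -
  have xH: "x \<in> Hom Top_mtr U ZT" using Cmp_Hom_Top[OF h y] by (simp only: x)
  have U: "tdom x = U" "metrizable_space U" "tdom y = U'" "metrizable_space U'"
    using h y xH by (simp_all add: Hom_iff)
  note px = prj_Hom[OF U(2,1)] and py = prj_Hom[OF U(4,3)] and fx = prF_Hom[OF xH] and fy = prF_Hom[OF y]
  have "continuous_map (U \<otimes>\<^sub>T ZT) U' (tfun h \<circ> pfst)"
    by (rule continuous_map_compose[OF continuous_pfst]) (use h in \<open>simp add: Hom_iff\<close>)
  then have k: "?k \<in> Hom Top_mtr (U \<otimes>\<^sub>T ZT) (U' \<otimes>\<^sub>T ZT)"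
    by (intro mk_tmap_Hom metrizable_times U metrizable_ZT continuous_Pair continuous_psnd) (simp add: comp_def)
  show eq: "times_F Top_mtr D h x y = ?k"
    unfolding times_F_def
  proof (rule the_equality)
    have "prj D y \<cdot>\<^bsub>Top_mtr\<^esub> ?k = h \<cdot>\<^bsub>Top_mtr\<^esub> prj D x"
    proof (rule tmap_eqI[OF Cmp_Hom_Top[OF k py] Cmp_Hom_Top[OF px h]])
      fix w assume w: "w \<in> topspace (U \<otimes>\<^sub>T ZT)"
      show "tfun (prj D y \<cdot>\<^bsub>Top_mtr\<^esub> ?k) w = tfun (h \<cdot>\<^bsub>Top_mtr\<^esub> prj D x) w"
        unfolding tfun_Cmp[OF k w] tfun_Cmp[OF px w] using w Hom_in[OF h] by (auto simp: U)
    qed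
    moreover have "prF D y \<cdot>\<^bsub>Top_mtr\<^esub> ?k = prF D x"
    proof (rule tmap_eqI[OF Cmp_Hom_Top[OF k fy] fx])
      fix w assume w: "w \<in> topspace (U \<otimes>\<^sub>T ZT)"
      have "tfun x u = tfun y (tfun h u)" if "u \<in> topspace U" for u
        using tfun_Cmp[OF h that, of y] by (simp only: x)
      then show "tfun (prF D y \<cdot>\<^bsub>Top_mtr\<^esub> ?k) w = tfun (prF D x) w"
        unfolding tfun_Cmp[OF k w] using w Hom_in[OF h] by (auto simp: U)
    qed
    ultimately show "?k \<in> Hom Top_mtr (Ext D x) (Ext D y) \<and>
        prj D y \<cdot>\<^bsub>Top_mtr\<^esub> ?k = h \<cdot>\<^bsub>Top_mtr\<^esub> prj D x \<and> prF D y \<cdot>\<^bsub>Top_mtr\<^esub> ?k = prF D x"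
      using k U by simp
    fix l assume l': "l \<in> Hom Top_mtr (Ext D x) (Ext D y) \<and>
        prj D y \<cdot>\<^bsub>Top_mtr\<^esub> l = h \<cdot>\<^bsub>Top_mtr\<^esub> prj D x \<and> prF D y \<cdot>\<^bsub>Top_mtr\<^esub> l = prF D x"
    then have l: "l \<in> Hom Top_mtr (U \<otimes>\<^sub>T ZT) (U' \<otimes>\<^sub>T ZT)" using U by simp
    show "l = ?k"
    proof (rule tmap_eqI[OF l k])
      fix w assume w: "w \<in> topspace (U \<otimes>\<^sub>T ZT)"
      have eq: "tfun (prj D y) (tfun l w) = tfun h (tfun (prj D x) w)" "tfun (prF D y) (tfun l w) = tfun (prF D x) w"
        using tfun_Cmp[OF l w, of "prj D y"] tfun_Cmp[OF l w, of "prF D y"] tfun_Cmp[OF px w, of h] l' by metis+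
      obtain u i where "tfun l w = Pair u (Padic i)" "u \<in> topspace U'" "i \<in> carrier Z"
        by (rule times_ZT_cases[OF Hom_in[OF l w]])
      then show "tfun l w = tfun ?k w"
        using eq w by (auto simp: U)
    qed
  qed
  show "times_F Top_mtr D h x y \<in> Hom Top_mtr (U \<otimes>\<^sub>T ZT) (U' \<otimes>\<^sub>T ZT)"
    unfolding eq by (rule k)
qed

lemma switch_D:
  assumes x: "x \<in> Hom Top_mtr U ZT" and y: "y \<in> Hom Top_mtr U ZT"
  shows "switch Top_mtr D x y = mk_tmap ((U \<otimes>\<^sub>T ZT) \<otimes>\<^sub>T ZT) ((U \<otimes>\<^sub>T ZT) \<otimes>\<^sub>T ZT)
      (\<lambda>w. Pair (Pair (pfst (pfst w)) (psnd w)) (psnd (pfst w)))" (is "_ = ?k")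
    and switch_Hom: "switch Top_mtr D x y \<in> Hom Top_mtr ((U \<otimes>\<^sub>T ZT) \<otimes>\<^sub>T ZT) ((U \<otimes>\<^sub>T ZT) \<otimes>\<^sub>T ZT)"
proof -
  let ?E = "(U \<otimes>\<^sub>T ZT) \<otimes>\<^sub>T ZT"
  have U: "tdom x = U" "tdom y = U" "metrizable_space U"
    using x y by (simp_all add: Hom_iff)
  have UZ: "metrizable_space (U \<otimes>\<^sub>T ZT)" by (intro metrizable_times U metrizable_ZT)
  define xy where "xy = x \<cdot>\<^bsub>Top_mtr\<^esub> prj D y"
  define yx where "yx = y \<cdot>\<^bsub>Top_mtr\<^esub> prj D x"
  note px = prj_Hom[OF U(3,1)] and py = prj_Hom[OF U(3,2)] and fx = prF_Hom[OF x] and fy = prF_Hom[OF y]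
  have xy: "xy \<in> Hom Top_mtr (U \<otimes>\<^sub>T ZT) ZT" and yx: "yx \<in> Hom Top_mtr (U \<otimes>\<^sub>T ZT) ZT"
    unfolding xy_def yx_def by (rule Cmp_Hom_Top[OF py x], rule Cmp_Hom_Top[OF px y])
  have dom: "tdom xy = U \<otimes>\<^sub>T ZT" "tdom yx = U \<otimes>\<^sub>T ZT"
    using xy yx by (simp_all add: Hom_iff)
  note pxy = prj_Hom[OF UZ dom(1)] and pyx = prj_Hom[OF UZ dom(2)] and fxy = prF_Hom[OF xy] and fyx = prF_Hom[OF yx]
  have vals: "tfun xy v = tfun x (pfst v)" "tfun yx v = tfun y (pfst v)" if v: "v \<in> topspace (U \<otimes>\<^sub>T ZT)" for v
    unfolding xy_def yx_def tfun_Cmp[OF py v] tfun_Cmp[OF px v] using v by (simp_all add: U)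
  have pp: "continuous_map ?E U (\<lambda>w. pfst (pfst w))" "continuous_map ?E ZT (\<lambda>w. psnd (pfst w))"
    using continuous_map_compose[OF continuous_pfst continuous_pfst]
      continuous_map_compose[OF continuous_pfst continuous_psnd] by (simp_all add: comp_def)
  have k: "?k \<in> Hom Top_mtr ?E ?E"
    by (intro mk_tmap_Hom metrizable_times U metrizable_ZT continuous_Pair pp continuous_psnd)
  show eq: "switch Top_mtr D x y = ?k"
    unfolding switch_def Let_def xy_def[symmetric] yx_def[symmetric]
  proof (rule the_equality)
    have "prj D y \<cdot>\<^bsub>Top_mtr\<^esub> (prj D xy \<cdot>\<^bsub>Top_mtr\<^esub> ?k) = prj D x \<cdot>\<^bsub>Top_mtr\<^esub> prj D yx"
    proof (rule tmap_eqI[OF Cmp_Hom_Top[OF Cmp_Hom_Top[OF k pxy] py] Cmp_Hom_Top[OF pyx px]])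
      fix w assume w: "w \<in> topspace ?E"
      then obtain u i j where "w = Pair (Pair u (Padic i)) (Padic j)"
          "u \<in> topspace U" "i \<in> carrier Z" "j \<in> carrier Z" by auto
      then show "tfun (prj D y \<cdot>\<^bsub>Top_mtr\<^esub> (prj D xy \<cdot>\<^bsub>Top_mtr\<^esub> ?k)) w = tfun (prj D x \<cdot>\<^bsub>Top_mtr\<^esub> prj D yx) w"
        unfolding tfun_Cmp[OF Cmp_Hom_Top[OF k pxy] w] tfun_Cmp[OF k w] tfun_Cmp[OF pyx w]
        by (simp add: U dom)
    qed
    moreover have "prF D xy \<cdot>\<^bsub>Top_mtr\<^esub> ?k = prF D x \<cdot>\<^bsub>Top_mtr\<^esub> prj D yx"
    proof (rule tmap_eqI[OF Cmp_Hom_Top[OF k fxy] Cmp_Hom_Top[OF pyx fx]])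
      fix w assume w: "w \<in> topspace ?E"
      then obtain u i j where "w = Pair (Pair u (Padic i)) (Padic j)"
          "u \<in> topspace U" "i \<in> carrier Z" "j \<in> carrier Z" by auto
      then show "tfun (prF D xy \<cdot>\<^bsub>Top_mtr\<^esub> ?k) w = tfun (prF D x \<cdot>\<^bsub>Top_mtr\<^esub> prj D yx) w"
        unfolding tfun_Cmp[OF k w] tfun_Cmp[OF pyx w]
        by (simp add: U dom vals)
    qed
    moreover have "prF D y \<cdot>\<^bsub>Top_mtr\<^esub> (prj D xy \<cdot>\<^bsub>Top_mtr\<^esub> ?k) = prF D yx"
    proof (rule tmap_eqI[OF Cmp_Hom_Top[OF Cmp_Hom_Top[OF k pxy] fy] fyx])
      fix w assume w: "w \<in> topspace ?E"
      then obtain u i j where "w = Pair (Pair u (Padic i)) (Padic j)"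
          "u \<in> topspace U" "i \<in> carrier Z" "j \<in> carrier Z" by auto
      then show "tfun (prF D y \<cdot>\<^bsub>Top_mtr\<^esub> (prj D xy \<cdot>\<^bsub>Top_mtr\<^esub> ?k)) w = tfun (prF D yx) w"
        unfolding tfun_Cmp[OF Cmp_Hom_Top[OF k pxy] w] tfun_Cmp[OF k w]
        by (simp add: U dom vals)
    qed
    ultimately show "?k \<in> Hom Top_mtr (Ext D yx) (Ext D xy) \<and>
        prj D y \<cdot>\<^bsub>Top_mtr\<^esub> (prj D xy \<cdot>\<^bsub>Top_mtr\<^esub> ?k) = prj D x \<cdot>\<^bsub>Top_mtr\<^esub> prj D yx \<and>
        prF D xy \<cdot>\<^bsub>Top_mtr\<^esub> ?k = prF D x \<cdot>\<^bsub>Top_mtr\<^esub> prj D yx \<and>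
        prF D y \<cdot>\<^bsub>Top_mtr\<^esub> (prj D xy \<cdot>\<^bsub>Top_mtr\<^esub> ?k) = prF D yx"
      using k dom by (simp only: adder_simps simp_thms)
    fix l assume l': "l \<in> Hom Top_mtr (Ext D yx) (Ext D xy) \<and>
        prj D y \<cdot>\<^bsub>Top_mtr\<^esub> (prj D xy \<cdot>\<^bsub>Top_mtr\<^esub> l) = prj D x \<cdot>\<^bsub>Top_mtr\<^esub> prj D yx \<and>
        prF D xy \<cdot>\<^bsub>Top_mtr\<^esub> l = prF D x \<cdot>\<^bsub>Top_mtr\<^esub> prj D yx \<and>
        prF D y \<cdot>\<^bsub>Top_mtr\<^esub> (prj D xy \<cdot>\<^bsub>Top_mtr\<^esub> l) = prF D yx"
    then have l: "l \<in> Hom Top_mtr ?E ?E" using dom by simp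
    show "l = ?k"
    proof (rule tmap_eqI[OF l k])
      fix w assume w: "w \<in> topspace ?E"
      have "tfun (prj D y) (tfun (prj D xy) (tfun l w)) = tfun (prj D x) (tfun (prj D yx) w)"
          "tfun (prF D xy) (tfun l w) = tfun (prF D x) (tfun (prj D yx) w)"
          "tfun (prF D y) (tfun (prj D xy) (tfun l w)) = tfun (prF D yx) w"
        using l' tfun_Cmp[OF Cmp_Hom_Top[OF l pxy] w, of "prj D y"] tfun_Cmp[OF Cmp_Hom_Top[OF l pxy] w, of "prF D y"]
          tfun_Cmp[OF l w, of "prj D xy"] tfun_Cmp[OF l w, of "prF D xy"]
          tfun_Cmp[OF pyx w, of "prj D x"] tfun_Cmp[OF pyx w, of "prF D x"] by metis+
      moreover obtain v j where "tfun l w = Pair v (Padic j)" "v \<in> topspace (U \<otimes>\<^sub>T ZT)" "j \<in> carrier Z"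
        by (rule times_ZT_cases[OF Hom_in[OF l w]])
      ultimately show "tfun l w = tfun ?k w"
        using w by (auto simp: U dom)
    qed
  qed
  show "switch Top_mtr D x y \<in> Hom Top_mtr ?E ?E"
    unfolding eq by (rule k)
qed

lemma prj_Flat_D:
  assumes x: "x \<in> Hom Top_mtr U ZT" and f: "f \<in> Hom Top_mtr (U \<otimes>\<^sub>T ZT) ZT"
  shows "prj D (Sig D x f) \<cdot>\<^bsub>Top_mtr\<^esub> Flat D x f = prj D x \<cdot>\<^bsub>Top_mtr\<^esub> prj D f"
proof -
  have U: "tdom x = U" "metrizable_space U" "tdom f = U \<otimes>\<^sub>T ZT" "metrizable_space (U \<otimes>\<^sub>T ZT)"
    and S: "tdom (Sig D x f) = U"
    using x f Sig_Hom_Top[OF x f] by (simp_all add: Hom_iff)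
  note fl = Flat_Hom_Top[OF x f] and ps = prj_Hom[OF U(2) S] and px = prj_Hom[OF U(2,1)] and pf = prj_Hom[OF U(4,3)]
  show ?thesis
  proof (rule tmap_eqI[OF Cmp_Hom_Top[OF fl ps] Cmp_Hom_Top[OF pf px]])
    fix w assume w: "w \<in> topspace ((U \<otimes>\<^sub>T ZT) \<otimes>\<^sub>T ZT)"
    then obtain u i j where uij: "w = Pair (Pair u (Padic i)) (Padic j)" "u \<in> topspace U" "i \<in> carrier Z" "j \<in> carrier Z"
      by auto
    have "tfun (Flat D x f) w \<in> topspace (U \<otimes>\<^sub>T ZT)" by (rule Hom_in[OF fl w])
    then show "tfun (prj D (Sig D x f) \<cdot>\<^bsub>Top_mtr\<^esub> Flat D x f) w = tfun (prj D x \<cdot>\<^bsub>Top_mtr\<^esub> prj D f) w"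
      unfolding tfun_Cmp[OF fl w] tfun_Cmp[OF pf w]
      using uij tfun_Flat[OF U(1) uij(2-4), of f] by (auto simp: U S)
  qed
qed

text \<open>The value of the sum at \<open>u\<close> depends only on the fibre over \<open>u\<close>, and \<open>h\<close> identifies that fibre with
  the one over \<open>h(u)\<close>.\<close>

lemma Sig_natural_D:
  assumes h: "h \<in> Hom Top_mtr U U'" and y: "y \<in> Hom Top_mtr U' ZT" and x: "y \<cdot>\<^bsub>Top_mtr\<^esub> h = x"
    and g: "g \<in> Hom Top_mtr (U' \<otimes>\<^sub>T ZT) ZT"
  shows "Sig D x (g \<cdot>\<^bsub>Top_mtr\<^esub> times_F Top_mtr D h x y) = Sig D y g \<cdot>\<^bsub>Top_mtr\<^esub> h"
proof -
  have xH: "x \<in> Hom Top_mtr U ZT" using Cmp_Hom_Top[OF h y] by (simp only: x)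
  note t = times_F_Hom[OF h y x]
  note gt = Cmp_Hom_Top[OF t g]
  note Sx = Sig_Hom_Top[OF xH gt] and Sy = Sig_Hom_Top[OF y g]
  show ?thesis
  proof (rule tmap_eqI[OF Sx Cmp_Hom_Top[OF h Sy]])
    fix u assume u: "u \<in> topspace U"
    note hu = Hom_in[OF h u]
    have fib: "fib (g \<cdot>\<^bsub>Top_mtr\<^esub> times_F Top_mtr D h x y) u i = fib g (tfun h u) i" if i: "i \<in> carrier Z" for i
    proof -
      have w: "Pair u (Padic i) \<in> topspace (U \<otimes>\<^sub>T ZT)" using u i by simp
      have "tfun (times_F Top_mtr D h x y) (Pair u (Padic i)) = Pair (tfun h u) (Padic i)"
        unfolding times_F_D[OF h y x] using u i by simp
      then show ?thesis unfolding fib_def tfun_Cmp[OF t w] by (simp only:)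
    qed
    have "val x u = val y (tfun h u)"
      unfolding val_def x[symmetric] tfun_Cmp[OF h u] by (rule refl)
    moreover have "S (fib (g \<cdot>\<^bsub>Top_mtr\<^esub> times_F Top_mtr D h x y) u) = S (fib g (tfun h u))"
      by (rule ext, rule Zq_sum_cong[OF fib]) (use fib_closed[OF g hu] in blast)+
    ultimately show "tfun (Sig D x (g \<cdot>\<^bsub>Top_mtr\<^esub> times_F Top_mtr D h x y)) u = tfun (Sig D y g \<cdot>\<^bsub>Top_mtr\<^esub> h) u"
      unfolding tfun_Cmp[OF h u] Padic_val[OF Sx u] Padic_val[OF Sy hu]
      by (simp only: val_Sig[OF xH u] val_Sig[OF y hu])
  qed
qed

lemma right_unit_D:
  assumes x: "x \<in> Hom Top_mtr U ZT"
  shows "Sig D x (const_one Top_mtr D (U \<otimes>\<^sub>T ZT)) = x"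
proof -
  have U: "metrizable_space (U \<otimes>\<^sub>T ZT)"
    using x by (intro metrizable_times metrizable_ZT) (simp add: Hom_iff)
  note S = Sig_Hom_Top[OF x const_one_Hom[OF U]]
  show ?thesis
  proof (rule tmap_eqI[OF S x])
    fix u assume u: "u \<in> topspace U"
    have "S (fib (const_one Top_mtr D (U \<otimes>\<^sub>T ZT)) u) (val x u) = S (\<lambda>_. \<one>\<^bsub>Z\<^esub>) (val x u)"
      by (rule Zq_sum_cong) (use u in \<open>auto simp: fib_val val_const_one[OF U]\<close>)
    then show "tfun (Sig D x (const_one Top_mtr D (U \<otimes>\<^sub>T ZT))) u = tfun x u"
      unfolding Padic_val[OF S u] Padic_val[OF x u] val_Sig[OF x u]
      by (simp only: Zq_sum_const_one[OF val_closed[OF x u]])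
  qed
qed

text \<open>For the constant \<open>c = 1\<close> the flattening map is \<open>(u, i, j) \<mapsto> (u, j + i - 1)\<close>, and a sum with upper
  limit \<open>1\<close> is its value at \<open>j = 1\<close>.\<close>

lemma left_unit_D:
  assumes x: "x \<in> Hom Top_mtr U ZT" and f: "f \<in> Hom Top_mtr (U \<otimes>\<^sub>T ZT) ZT"
    and c: "c = const_one Top_mtr D (U \<otimes>\<^sub>T ZT)"
  shows "Sig D c (f \<cdot>\<^bsub>Top_mtr\<^esub> Flat D x c) = f"
proof -
  have U: "metrizable_space (U \<otimes>\<^sub>T ZT)"
    using x by (intro metrizable_times metrizable_ZT) (simp add: Hom_iff)
  have cH: "c \<in> Hom Top_mtr (U \<otimes>\<^sub>T ZT) ZT" unfolding c by (rule const_one_Hom[OF U])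
  note g = Cmp_Hom_Top[OF Flat_Hom_Top[OF x cH] f]
  note S = Sig_Hom_Top[OF cH g]
  show ?thesis
  proof (rule tmap_eqI[OF S f])
    fix w assume w: "w \<in> topspace (U \<otimes>\<^sub>T ZT)"
    then obtain u i where ui: "w = Pair u (Padic i)" "u \<in> topspace U" "i \<in> carrier Z"
      by (rule times_ZT_cases)
    have i1: "i \<ominus>\<^bsub>Z\<^esub> \<one>\<^bsub>Z\<^esub> \<in> carrier Z" using ui(3) by simp
    have "S (fib c u) (i \<ominus>\<^bsub>Z\<^esub> \<one>\<^bsub>Z\<^esub>) = S (\<lambda>_. \<one>\<^bsub>Z\<^esub>) (i \<ominus>\<^bsub>Z\<^esub> \<one>\<^bsub>Z\<^esub>)"
      by (rule Zq_sum_cong) (use ui in \<open>auto simp: c fib_val val_const_one[OF U]\<close>)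
    then have Sc: "S (fib c u) (i \<ominus>\<^bsub>Z\<^esub> \<one>\<^bsub>Z\<^esub>) = i \<ominus>\<^bsub>Z\<^esub> \<one>\<^bsub>Z\<^esub>"
      by (simp only: Zq_sum_const_one[OF i1])
    have "\<one>\<^bsub>Z\<^esub> \<oplus>\<^bsub>Z\<^esub> (i \<ominus>\<^bsub>Z\<^esub> \<one>\<^bsub>Z\<^esub>) = i"
      using ui(3) by (simp add: a_minus_def R.a_ac R.r_neg R.r_neg2)
    then have "fib (f \<cdot>\<^bsub>Top_mtr\<^esub> Flat D x c) w \<one>\<^bsub>Z\<^esub> = val f w"
      unfolding ui(1) fib_Cmp_Flat[OF x cH ui(2,3) R.one_closed] Sc by (simp only: fib_val)
    moreover have "val c w = \<one>\<^bsub>Z\<^esub>" unfolding c by (rule val_const_one[OF U w])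
    ultimately show "tfun (Sig D c (f \<cdot>\<^bsub>Top_mtr\<^esub> Flat D x c)) w = tfun f w"
      unfolding Padic_val[OF S w] Padic_val[OF f w] val_Sig[OF cH w]
      by (simp only: Zq_sum_at_one[OF fib_continuous[OF g w]])
  qed
qed

text \<open>\<open>Zq_sum_assoc\<close> in one fibre. The upper limit \<open>a\<close> is arbitrary: the sum associativity law needs it
  at \<open>x(u)\<close>, the flatten associativity law at \<open>i - 1\<close>.\<close>

lemma fib_Sig_assoc:
  assumes x: "x \<in> Hom Top_mtr U ZT" and f: "f \<in> Hom Top_mtr (U \<otimes>\<^sub>T ZT) ZT"
    and g: "g \<in> Hom Top_mtr (U \<otimes>\<^sub>T ZT) ZT" and u: "u \<in> topspace U" and a: "a \<in> carrier Z"
  shows "S (fib (Sig D f (g \<cdot>\<^bsub>Top_mtr\<^esub> Flat D x f)) u) a = S (fib g u) (S (fib f u) a)"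
proof -
  let ?g = "g \<cdot>\<^bsub>Top_mtr\<^esub> Flat D x f"
  have g': "?g \<in> Hom Top_mtr ((U \<otimes>\<^sub>T ZT) \<otimes>\<^sub>T ZT) ZT"
    by (rule Cmp_Hom_Top[OF Flat_Hom_Top[OF x f] g])
  note F = fib_continuous[OF f u] and G = fib_continuous[OF g u]
  have eq: "S (\<lambda>j. fib g u (j \<oplus>\<^bsub>Z\<^esub> S (fib f u) (i \<ominus>\<^bsub>Z\<^esub> \<one>\<^bsub>Z\<^esub>))) (fib f u i) = fib (Sig D f ?g) u i"
    if i: "i \<in> carrier Z" for i
    unfolding fib_Sig[OF f u i]
  proof (rule Zq_sum_cong)
    show "fib g u (j \<oplus>\<^bsub>Z\<^esub> S (fib f u) (i \<ominus>\<^bsub>Z\<^esub> \<one>\<^bsub>Z\<^esub>)) = fib ?g (Pair u (Padic i)) j" if "j \<in> carrier Z" for j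
      by (rule fib_Cmp_Flat[OF x f u i that, symmetric])
    have "Pair u (Padic i) \<in> topspace (U \<otimes>\<^sub>T ZT)" using u i by simp
    then show "fib ?g (Pair u (Padic i)) \<in> carrier Z \<rightarrow> carrier Z"
      using fib_closed[OF g'] by blast
  qed
  have "S (fib g u) (S (fib f u) a) =
      S (\<lambda>i. S (\<lambda>j. fib g u (j \<oplus>\<^bsub>Z\<^esub> S (fib f u) (i \<ominus>\<^bsub>Z\<^esub> \<one>\<^bsub>Z\<^esub>))) (fib f u i)) a"
    by (rule Zq_sum_assoc[OF F G a])
  also have "\<dots> = S (fib (Sig D f ?g) u) a"
  proof (rule Zq_sum_cong[OF eq])
    show "fib (Sig D f ?g) u \<in> carrier Z \<rightarrow> carrier Z"
      using fib_closed[OF Sig_Hom_Top[OF f g'] u] by blast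
  qed
  finally show ?thesis by (rule sym)
qed

lemma Sig_assoc_D:
  assumes x: "x \<in> Hom Top_mtr U ZT" and f: "f \<in> Hom Top_mtr (U \<otimes>\<^sub>T ZT) ZT"
    and g: "g \<in> Hom Top_mtr (U \<otimes>\<^sub>T ZT) ZT"
  shows "Sig D (Sig D x f) g = Sig D x (Sig D f (g \<cdot>\<^bsub>Top_mtr\<^esub> Flat D x f))"
proof -
  note s = Sig_Hom_Top[OF x f]
  note g' = Cmp_Hom_Top[OF Flat_Hom_Top[OF x f] g]
  note L = Sig_Hom_Top[OF s g] and R = Sig_Hom_Top[OF x Sig_Hom_Top[OF f g']]
  show ?thesis
  proof (rule tmap_eqI[OF L R])
    fix u assume u: "u \<in> topspace U"
    show "tfun (Sig D (Sig D x f) g) u = tfun (Sig D x (Sig D f (g \<cdot>\<^bsub>Top_mtr\<^esub> Flat D x f))) u"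
      unfolding Padic_val[OF L u] Padic_val[OF R u]
      by (simp only: val_Sig[OF s u] val_Sig[OF x u] fib_Sig_assoc[OF x f g u val_closed[OF x u]])
  qed
qed

text \<open>At \<open>(u, i, j, k)\<close>, with \<open>a = S F (i - 1)\<close> for \<open>F = f(u, -)\<close> and \<open>G = g(u, -)\<close>, the left side adds to
  \<open>k\<close> the sum of \<open>G\<close> up to \<open>j + a - 1\<close>. The right side adds the part of it after \<open>a\<close> and, by associativity,
  the part up to \<open>a\<close>.\<close>

lemma Flat_assoc_D:
  assumes x: "x \<in> Hom Top_mtr U ZT" and f: "f \<in> Hom Top_mtr (U \<otimes>\<^sub>T ZT) ZT"
    and g: "g \<in> Hom Top_mtr (U \<otimes>\<^sub>T ZT) ZT" and g'_def: "g' = g \<cdot>\<^bsub>Top_mtr\<^esub> Flat D x f"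
  shows "Flat D (Sig D x f) g \<cdot>\<^bsub>Top_mtr\<^esub> times_F Top_mtr D (Flat D x f) g' g =
    Flat D x (Sig D f g') \<cdot>\<^bsub>Top_mtr\<^esub> Flat D f g'"
proof -
  note s = Sig_Hom_Top[OF x f] and fl = Flat_Hom_Top[OF x f]
  have g': "g' \<in> Hom Top_mtr ((U \<otimes>\<^sub>T ZT) \<otimes>\<^sub>T ZT) ZT"
    unfolding g'_def by (rule Cmp_Hom_Top[OF fl g])
  note t = times_F_Hom[OF fl g g'_def[symmetric]] and A = Flat_Hom_Top[OF s g]
    and B = Flat_Hom_Top[OF f g'] and C = Flat_Hom_Top[OF x Sig_Hom_Top[OF f g']]
  have dom: "tdom x = U" "tdom f = U \<otimes>\<^sub>T ZT" "tdom (Sig D x f) = U"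
    using x f s by (simp_all add: Hom_iff)
  show ?thesis
  proof (rule tmap_eqI[OF Cmp_Hom_Top[OF t A] Cmp_Hom_Top[OF B C]])
    fix w assume w: "w \<in> topspace (((U \<otimes>\<^sub>T ZT) \<otimes>\<^sub>T ZT) \<otimes>\<^sub>T ZT)"
    then obtain u i j k where w_eq: "w = Pair (Pair (Pair u (Padic i)) (Padic j)) (Padic k)"
      and u: "u \<in> topspace U" and i: "i \<in> carrier Z" and j: "j \<in> carrier Z" and k: "k \<in> carrier Z"
      by auto
    define a where "a = S (fib f u) (i \<ominus>\<^bsub>Z\<^esub> \<one>\<^bsub>Z\<^esub>)"
    define G where "G = fib g u"
    have G: "continuous_map T T G" unfolding G_def by (rule fib_continuous[OF g u])
    have i1: "i \<ominus>\<^bsub>Z\<^esub> \<one>\<^bsub>Z\<^esub> \<in> carrier Z" and j1: "j \<ominus>\<^bsub>Z\<^esub> \<one>\<^bsub>Z\<^esub> \<in> carrier Z" using i j by simp_all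
    have a: "a \<in> carrier Z"
      unfolding a_def by (rule Zq_sum_closed[OF fib_continuous[OF f u] i1])
    have ui: "Pair u (Padic i) \<in> topspace (U \<otimes>\<^sub>T ZT)" using u i by simp
    define b where "b = S (fib g' (Pair u (Padic i))) (j \<ominus>\<^bsub>Z\<^esub> \<one>\<^bsub>Z\<^esub>)"
    have b: "b \<in> carrier Z"
      unfolding b_def by (rule Zq_sum_closed[OF fib_continuous[OF g' ui] j1])
    have "continuous_map T T (G \<circ> (\<lambda>j. j \<oplus>\<^bsub>Z\<^esub> a))"
      by (intro continuous_map_compose[OF _ G] continuous_map_T_add) (simp_all add: a)
    then have shift: "continuous_map T T (\<lambda>j. G (j \<oplus>\<^bsub>Z\<^esub> a))" by (simp add: comp_def)
    have "b = S (\<lambda>j. G (j \<oplus>\<^bsub>Z\<^esub> a)) (j \<ominus>\<^bsub>Z\<^esub> \<one>\<^bsub>Z\<^esub>)"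
      unfolding b_def
    proof (rule Zq_sum_cong)
      show "fib g' (Pair u (Padic i)) j = G (j \<oplus>\<^bsub>Z\<^esub> a)" if "j \<in> carrier Z" for j
        unfolding g'_def G_def a_def by (rule fib_Cmp_Flat[OF x f u i that])
      show "(\<lambda>j. G (j \<oplus>\<^bsub>Z\<^esub> a)) \<in> carrier Z \<rightarrow> carrier Z"
        using continuous_closed[OF shift] by blast
    qed
    then have split: "S G (a \<oplus>\<^bsub>Z\<^esub> (j \<ominus>\<^bsub>Z\<^esub> \<one>\<^bsub>Z\<^esub>)) = S G a \<oplus>\<^bsub>Z\<^esub> b"
      by (simp only: Zq_sum_split[OF G a j1])
    have SGa: "S G a \<in> carrier Z" by (rule Zq_sum_closed[OF G a])
    have ja: "j \<oplus>\<^bsub>Z\<^esub> a \<in> carrier Z" and kb: "k \<oplus>\<^bsub>Z\<^esub> b \<in> carrier Z" using j a k b by simp_all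
    have "tfun (times_F Top_mtr D (Flat D x f) g' g) w = Pair (tfun (Flat D x f) (Pair (Pair u (Padic i)) (Padic j))) (Padic k)"
      unfolding times_F_D[OF fl g g'_def[symmetric]] using w by (simp add: w_eq)
    also have "\<dots> = Pair (Pair u (Padic (j \<oplus>\<^bsub>Z\<^esub> a))) (Padic k)"
      unfolding tfun_Flat[OF dom(1) u i j] a_def by (rule refl)
    finally have lhs: "tfun (Flat D (Sig D x f) g \<cdot>\<^bsub>Top_mtr\<^esub> times_F Top_mtr D (Flat D x f) g' g) w =
        Pair u (Padic (k \<oplus>\<^bsub>Z\<^esub> S G (j \<oplus>\<^bsub>Z\<^esub> a \<ominus>\<^bsub>Z\<^esub> \<one>\<^bsub>Z\<^esub>)))"
      unfolding tfun_Cmp[OF t w] G_def by (simp only: tfun_Flat[OF dom(3) u ja k])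
    have "tfun (Flat D f g') w = Pair (Pair u (Padic i)) (Padic (k \<oplus>\<^bsub>Z\<^esub> b))"
      unfolding w_eq tfun_Flat[OF dom(2) ui j k] b_def by (rule refl)
    then have rhs: "tfun (Flat D x (Sig D f g') \<cdot>\<^bsub>Top_mtr\<^esub> Flat D f g') w =
        Pair u (Padic (k \<oplus>\<^bsub>Z\<^esub> b \<oplus>\<^bsub>Z\<^esub> S G a))"
      unfolding tfun_Cmp[OF B w] G_def a_def
      by (simp only: tfun_Flat[OF dom(1) u i kb] g'_def fib_Sig_assoc[OF x f g u i1])
    have "j \<oplus>\<^bsub>Z\<^esub> a \<ominus>\<^bsub>Z\<^esub> \<one>\<^bsub>Z\<^esub> = a \<oplus>\<^bsub>Z\<^esub> (j \<ominus>\<^bsub>Z\<^esub> \<one>\<^bsub>Z\<^esub>)"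
      using j a by (simp add: a_minus_def R.a_ac)
    then have "k \<oplus>\<^bsub>Z\<^esub> S G (j \<oplus>\<^bsub>Z\<^esub> a \<ominus>\<^bsub>Z\<^esub> \<one>\<^bsub>Z\<^esub>) = k \<oplus>\<^bsub>Z\<^esub> b \<oplus>\<^bsub>Z\<^esub> S G a"
      using k b SGa by (simp add: split R.a_ac)
    then show "tfun (Flat D (Sig D x f) g \<cdot>\<^bsub>Top_mtr\<^esub> times_F Top_mtr D (Flat D x f) g' g) w =
        tfun (Flat D x (Sig D f g') \<cdot>\<^bsub>Top_mtr\<^esub> Flat D f g') w"
      unfolding lhs rhs by (simp only:)
  qed
qed

text \<open>In each fibre the two sides are the iterated sums of one function of two variables, so this is
  \<open>Zq_sum_swap\<close>.\<close>

lemma commutative_D: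
  assumes x: "x \<in> Hom Top_mtr U ZT" and y: "y \<in> Hom Top_mtr U ZT"
    and f: "f \<in> Hom Top_mtr ((U \<otimes>\<^sub>T ZT) \<otimes>\<^sub>T ZT) ZT"
  shows "Sig D y (Sig D (x \<cdot>\<^bsub>Top_mtr\<^esub> prj D y) f) =
    Sig D x (Sig D (y \<cdot>\<^bsub>Top_mtr\<^esub> prj D x) (f \<cdot>\<^bsub>Top_mtr\<^esub> switch Top_mtr D x y))"
proof -
  have U: "tdom x = U" "tdom y = U" "metrizable_space U"
    using x y by (simp_all add: Hom_iff)
  note px = prj_Hom[OF U(3,1)] and py = prj_Hom[OF U(3,2)]
  note xy = Cmp_Hom_Top[OF py x] and yx = Cmp_Hom_Top[OF px y]
  note k = switch_Hom[OF x y]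
  note fk = Cmp_Hom_Top[OF k f]
  note Sf = Sig_Hom_Top[OF xy f] and Sfk = Sig_Hom_Top[OF yx fk]
  note L = Sig_Hom_Top[OF y Sf] and R = Sig_Hom_Top[OF x Sfk]
  show ?thesis
  proof (rule tmap_eqI[OF L R])
    fix u assume u: "u \<in> topspace U"
    note xu = val_closed[OF x u] and yu = val_closed[OF y u]
    have ui: "Pair u (Padic i) \<in> topspace (U \<otimes>\<^sub>T ZT)" if "i \<in> carrier Z" for i
      using u that by simp
    define F where "F j = fib f (Pair u (Padic j))" for j
    have "continuous_map (prod_topology T T) (prod_topology (U \<otimes>\<^sub>T ZT) T) (\<lambda>p. (Pair u (Padic (fst p)), snd p))"
      by (intro continuous_map_pairedI continuous_Pair continuous_Padic continuous_map_fst continuous_map_snd)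
         (simp add: u)
    from continuous_map_compose[OF this fib_joint_continuous[OF f]]
    have F: "continuous_map (prod_topology T T) T (\<lambda>(j, i). F j i)"
      by (simp add: comp_def case_prod_unfold F_def)
    have F_closed: "F j i \<in> carrier Z" if "j \<in> carrier Z" "i \<in> carrier Z" for j i
      unfolding F_def by (rule fib_closed[OF f ui[OF that(1)] that(2)])
    have vals: "val (x \<cdot>\<^bsub>Top_mtr\<^esub> prj D y) (Pair u (Padic i)) = val x u"
        "val (y \<cdot>\<^bsub>Top_mtr\<^esub> prj D x) (Pair u (Padic i)) = val y u" if i: "i \<in> carrier Z" for i
      unfolding val_def tfun_Cmp[OF py ui[OF i]] tfun_Cmp[OF px ui[OF i]] using u i by (simp_all add: U)
    have "S (fib (Sig D (x \<cdot>\<^bsub>Top_mtr\<^esub> prj D y) f) u) (val y u) = S (\<lambda>j. S (F j) (val x u)) (val y u)"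
    proof (rule Zq_sum_cong)
      show "fib (Sig D (x \<cdot>\<^bsub>Top_mtr\<^esub> prj D y) f) u j = S (F j) (val x u)" if j: "j \<in> carrier Z" for j
        unfolding fib_val[of _ u] val_Sig[OF xy ui[OF j]] vals(1)[OF j] F_def by (rule refl)
      show "(\<lambda>j. S (F j) (val x u)) \<in> carrier Z \<rightarrow> carrier Z"
        unfolding F_def using Zq_sum_closed[OF fib_continuous[OF f ui] xu] by blast
    qed
    also have "\<dots> = S (\<lambda>i. S (\<lambda>j. F j i) (val y u)) (val x u)"
      by (rule Zq_sum_swap[OF F xu yu])
    also have "\<dots> = S (fib (Sig D (y \<cdot>\<^bsub>Top_mtr\<^esub> prj D x) (f \<cdot>\<^bsub>Top_mtr\<^esub> switch Top_mtr D x y)) u) (val x u)"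
    proof (rule Zq_sum_cong)
      show "S (\<lambda>j. F j i) (val y u) = fib (Sig D (y \<cdot>\<^bsub>Top_mtr\<^esub> prj D x) (f \<cdot>\<^bsub>Top_mtr\<^esub> switch Top_mtr D x y)) u i"
        if i: "i \<in> carrier Z" for i
        unfolding fib_val[of _ u] val_Sig[OF yx ui[OF i]] vals(2)[OF i]
      proof (rule Zq_sum_cong[symmetric])
        show "fib (f \<cdot>\<^bsub>Top_mtr\<^esub> switch Top_mtr D x y) (Pair u (Padic i)) j = F j i" if j: "j \<in> carrier Z" for j
        proof -
          have w: "Pair (Pair u (Padic i)) (Padic j) \<in> topspace ((U \<otimes>\<^sub>T ZT) \<otimes>\<^sub>T ZT)"
            using u i j by simp
          have "tfun (switch Top_mtr D x y) (Pair (Pair u (Padic i)) (Padic j)) = Pair (Pair u (Padic j)) (Padic i)"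
            unfolding switch_D[OF x y] using w by simp
          then show ?thesis unfolding fib_def F_def tfun_Cmp[OF k w] by (simp only:)
        qed
        show "(\<lambda>j. F j i) \<in> carrier Z \<rightarrow> carrier Z" using F_closed i by blast
      qed
      show "fib (Sig D (y \<cdot>\<^bsub>Top_mtr\<^esub> prj D x) (f \<cdot>\<^bsub>Top_mtr\<^esub> switch Top_mtr D x y)) u \<in> carrier Z \<rightarrow> carrier Z"
        using fib_closed[OF Sfk u] by blast
    qed
    finally show "tfun (Sig D y (Sig D (x \<cdot>\<^bsub>Top_mtr\<^esub> prj D y) f)) u =
        tfun (Sig D x (Sig D (y \<cdot>\<^bsub>Top_mtr\<^esub> prj D x) (f \<cdot>\<^bsub>Top_mtr\<^esub> switch Top_mtr D x y))) u"
      unfolding Padic_val[OF L u] Padic_val[OF R u] val_Sig[OF y u] val_Sig[OF x u] by (simp only:)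
  qed
qed

lemma commutative_dependent_adder_Zq:
  "commutative_dependent_adder (Top_mtr :: ('a point topology, 'a point tmap) category) D"
proof -
  have ext: "f \<in> Hom Top_mtr (tdom x \<otimes>\<^sub>T ZT) ZT" if "f \<in> Hom Top_mtr (Ext D x) (A\<^sub>D D)"
    for f x :: "'a point tmap" using that by (simp only: adder_simps)
  have ext': "g \<in> Hom Top_mtr (tdom x \<otimes>\<^sub>T ZT) ZT" if "g \<in> Hom Top_mtr (Ext D (Sig D x f)) (A\<^sub>D D)"
    for g f x :: "'a point tmap" using that by (simp only: adder_simps Sig_D mk_tmap_simps)
  have ov: "x \<in> Hom Top_mtr (tdom x) ZT" if "x \<in> over Top_mtr D" for x :: "'a point tmap"
    using that by (simp only: over_iff)
  have hom: "x \<in> Hom Top_mtr U ZT" "tdom x = U" if "x \<in> Hom Top_mtr U (A\<^sub>D D)"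
    for x :: "'a point tmap" and U using that by (simp_all add: Hom_iff)
  show ?thesis
  proof (intro commutative_dependent_adder.intro dependent_adder.intro finitely_complete_Top_mtr
      dependent_adder_axioms.intro commutative_dependent_adder_axioms.intro)
    show "is_terminal Top_mtr (T\<^sub>D (D :: ('a point topology, 'a point tmap) adder))"
      by (simp only: adder_simps star_terminal)
    show "A\<^sub>D D \<in> Obj (Top_mtr :: ('a point topology, 'a point tmap) category)"
      by (simp add: metrizable_ZT)
    show "p\<^sub>D D \<in> Hom Top_mtr (F\<^sub>D D) (A\<^sub>D (D :: ('a point topology, 'a point tmap) adder))"
      by (simp add: mk_tmap_Hom metrizable_times metrizable_ZT continuous_psnd)
    show "oneF D \<in> Hom Top_mtr (T\<^sub>D D) (F\<^sub>D (D :: ('a point topology, 'a point tmap) adder))"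
      by (simp add: mk_tmap_Hom metrizable_star metrizable_times metrizable_ZT)
  next
    fix x :: "'a point tmap" assume x: "x \<in> over Top_mtr D"
    show "is_pullback Top_mtr x (p\<^sub>D D) (Ext D x) (prj D x) (prF D x)"
      by (rule pullback_D[OF ov[OF x]])
    show "Sig D x (const_one Top_mtr D (Ext D x)) = x"
      unfolding adder_simps by (rule right_unit_D[OF ov[OF x]])
    fix f assume f: "f \<in> Hom Top_mtr (Ext D x) (A\<^sub>D D)"
    have f': "tdom f = tdom x \<otimes>\<^sub>T ZT" using ext[OF f] by (simp add: Hom_iff)
    show "Flat D x f \<in> Hom Top_mtr (Ext D f) (Ext D (Sig D x f))"
      using Flat_Hom_Top[OF ov[OF x] ext[OF f]] by (simp only: adder_simps f' Sig_D mk_tmap_simps)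
    show "prj D (Sig D x f) \<cdot>\<^bsub>Top_mtr\<^esub> Flat D x f = prj D x \<cdot>\<^bsub>Top_mtr\<^esub> prj D f"
      by (rule prj_Flat_D[OF ov[OF x] ext[OF f]])
    show "Sig D c (f \<cdot>\<^bsub>Top_mtr\<^esub> Flat D x c) = f" if "c = const_one Top_mtr D (Ext D x)" for c
      using that unfolding adder_simps by (rule left_unit_D[OF ov[OF x] ext[OF f]])
    fix g assume g: "g \<in> Hom Top_mtr (Ext D (Sig D x f)) (A\<^sub>D D)"
    show "Sig D (Sig D x f) g = Sig D x (Sig D f (g \<cdot>\<^bsub>Top_mtr\<^esub> Flat D x f))"
      by (rule Sig_assoc_D[OF ov[OF x] ext[OF f] ext'[OF g]])
    show "Flat D (Sig D x f) g \<cdot>\<^bsub>Top_mtr\<^esub> times_F Top_mtr D (Flat D x f) g' g =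
        Flat D x (Sig D f g') \<cdot>\<^bsub>Top_mtr\<^esub> Flat D f g'" if "g' = g \<cdot>\<^bsub>Top_mtr\<^esub> Flat D x f" for g'
      by (rule Flat_assoc_D[OF ov[OF x] ext[OF f] ext'[OF g] that])
  next
    fix x g :: "'a point tmap" and U
    assume x: "x \<in> Hom Top_mtr U (A\<^sub>D D)" and g: "g \<in> Hom Top_mtr (Ext D x) (A\<^sub>D D)"
    show "Sig D x g \<in> Hom Top_mtr U (A\<^sub>D D)"
      using Sig_Hom_Top[OF hom(1)[OF x]] ext[OF g] hom(2)[OF x] by (simp only: adder_simps)
  next
    fix h y x g :: "'a point tmap" and U U'
    assume h: "h \<in> Hom Top_mtr U U'" and y: "y \<in> Hom Top_mtr U' (A\<^sub>D D)" and x: "y \<cdot>\<^bsub>Top_mtr\<^esub> h = x"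
      and g: "g \<in> Hom Top_mtr (Ext D y) (A\<^sub>D D)"
    have "g \<in> Hom Top_mtr (U' \<otimes>\<^sub>T ZT) ZT" using ext[OF g] by (simp only: hom(2)[OF y])
    then show "Sig D x (g \<cdot>\<^bsub>Top_mtr\<^esub> times_F Top_mtr D h x y) = Sig D y g \<cdot>\<^bsub>Top_mtr\<^esub> h"
      by (rule Sig_natural_D[OF h hom(1)[OF y] x])
  next
    fix x y f :: "'a point tmap" and U
    assume x: "x \<in> Hom Top_mtr U (A\<^sub>D D)" and y: "y \<in> Hom Top_mtr U (A\<^sub>D D)"
      and f: "f \<in> Hom Top_mtr (Ext D (x \<cdot>\<^bsub>Top_mtr\<^esub> prj D y)) (A\<^sub>D D)"
    have "f \<in> Hom Top_mtr ((U \<otimes>\<^sub>T ZT) \<otimes>\<^sub>T ZT) ZT"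
      using ext[OF f] hom(2)[OF y] by simp
    then show "Sig D y (Sig D (x \<cdot>\<^bsub>Top_mtr\<^esub> prj D y) f) =
        Sig D x (Sig D (y \<cdot>\<^bsub>Top_mtr\<^esub> prj D x) (f \<cdot>\<^bsub>Top_mtr\<^esub> switch Top_mtr D x y))"
      by (rule commutative_D[OF hom(1)[OF x] hom(1)[OF y]])
  qed
qed

end

theorem mainTheorem3:
  fixes q :: nat
  assumes "prime q"
  shows "commutative_dependent_adder (Top_mtr :: ('a point topology, 'a point tmap) category)
           (Zq_adder q)"
proof -
  interpret qadic q
    by unfold_locales (rule prime_gt_0_nat[OF assms])
  show ?thesis by (rule commutative_dependent_adder_Zq)
qed

end
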